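(* Let $\omega$ be an almost monotone weight on $\mathbb N^2$, and let $\widetilde a:\mathbb H^2\to\mathbb C$ have an $\omega$-absolutely convergent Dirichlet series. (I) If $\widetilde a$ is bounded away from zero on $\mathbb H^2$, then there is an almost monotone weight $\nu$ on $\mathbb N^2$ such that: $\nu$ is constant if and only if $\omega$ is constant; $\nu$ is admissible if and only if $\omega$ is admissible; $1\le\nu\le\omega$ pointwise; and $1/\widetilde a$ has a $\nu$-absolutely convergent Dirichlet series. (II) If $\varphi$ is holomorphic on an open neighbourhood of the closure of the range of $\widetilde a$, then there is an almost monotone weight $\xi$ on $\mathbb N^2$ such that: $\xi$ is constant if and only if $\omega$ is constant; $\xi$ is admissible if and only if $\omega$ is admissible; $1\le\xi\le\omega$ pointwise; and $\varphi\circ\widetilde a$ has a $\xi$-absolutely convergent Dirichlet series.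
   Context: $\mathbb N=\{1,2,\dots\}$; $p_1<p_2<\cdots$ are the primes in increasing order; $\mathbb H=\{z\in\mathbb C:\operatorname{Re}z\ge0\}$. $\mathbb N^2$ is a semigroup under coordinatewise multiplication. A weight on $\mathbb N^2$ is a map $\omega:\mathbb N^2\to[1,\infty)$ with $\omega((m_1,n_1)(m_2,n_2))\le\omega(m_1,n_1)\omega(m_2,n_2)$ for all $(m_1,n_1),(m_2,n_2)$. A weight $\omega$ is admissible if $\lim_{n\to\infty}\omega(l^n,k^n)^{1/n}=1$ for all $(l,k)\in\mathbb N^2$. A weight $\omega$ is almost monotone if either $\omega$ is admissible, or there is $K>0$ such that $\omega(m_1,n_1)\le K\omega(m_2,n_2)$ whenever $(m_1,n_1),(m_2,n_2)\in\mathbb N^2$ and either $m_1\mid m_2$ or $n_1\mid n_2$. For a weight $\omega$, a function $\widetilde a:\mathbb H^2\to\mathbb C$ has an $\omega$-absolutely convergent Dirichlet series if there is $a:\mathbb N^2\to\mathbb C$ with $\sum_{(m,n)\in\mathbb N^2}|a(m,n)|\omega(m,n)<\infty$ and $\widetilde a(s_1,s_2)=\sum_{(m,n)}a(m,n)m^{-s_1}n^{-s_2}$ for all $(s_1,s_2)\in\mathbb H^2$. $\widetilde a$ is bounded away from zero if there is $k>0$ with $|\widetilde a|\ge k$ on $\mathbb H^2$. *)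

theory Defs
  imports "HOL-Analysis.Analysis"
begin

text \<open>The semigroup N^2 (N = {1,2,...}) is represented as the pairs of positive naturals.
  Weights are functions nat \<times> nat \<Rightarrow> real; only their values on N2 matter.\<close>

definition N2 :: "(nat \<times> nat) set" where
  "N2 = {(m, n). 0 < m \<and> 0 < n}"

definition Hplane :: "complex set" where
  "Hplane = {z. 0 \<le> Re z}"

definition is_weight :: "(nat \<times> nat \<Rightarrow> real) \<Rightarrow> bool" where
  "is_weight \<omega> \<longleftrightarrow>
     (\<forall>x\<in>N2. 1 \<le> \<omega> x) \<and>
     (\<forall>m1 n1 m2 n2. (m1, n1) \<in> N2 \<longrightarrow> (m2, n2) \<in> N2 \<longrightarrow>
        \<omega> (m1 * m2, n1 * n2) \<le> \<omega> (m1, n1) * \<omega> (m2, n2))"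

definition admissible_weight :: "(nat \<times> nat \<Rightarrow> real) \<Rightarrow> bool" where
  "admissible_weight \<omega> \<longleftrightarrow> is_weight \<omega> \<and>
     (\<forall>l k. (l, k) \<in> N2 \<longrightarrow>
        (\<lambda>n. \<omega> (l ^ n, k ^ n) powr (1 / real n)) \<longlonglongrightarrow> 1)"

definition almost_monotone_weight :: "(nat \<times> nat \<Rightarrow> real) \<Rightarrow> bool" where
  "almost_monotone_weight \<omega> \<longleftrightarrow> is_weight \<omega> \<and>
     (admissible_weight \<omega> \<or>
      (\<exists>K>0. \<forall>m1 n1 m2 n2. (m1, n1) \<in> N2 \<longrightarrow> (m2, n2) \<in> N2 \<longrightarrow>
          (m1 dvd m2 \<or> n1 dvd n2) \<longrightarrow> \<omega> (m1, n1) \<le> K * \<omega> (m2, n2)))"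

definition constant_weight :: "(nat \<times> nat \<Rightarrow> real) \<Rightarrow> bool" where
  "constant_weight \<omega> \<longleftrightarrow> (\<exists>c. \<forall>x\<in>N2. \<omega> x = c)"

definition has_weighted_dirichlet ::
    "(nat \<times> nat \<Rightarrow> real) \<Rightarrow> (complex \<times> complex \<Rightarrow> complex) \<Rightarrow> bool" where
  "has_weighted_dirichlet \<omega> f \<longleftrightarrow>
     (\<exists>a :: nat \<times> nat \<Rightarrow> complex.
        (\<lambda>x. norm (a x) * \<omega> x) summable_on N2 \<and>
        (\<forall>s1 s2. s1 \<in> Hplane \<longrightarrow> s2 \<in> Hplane \<longrightarrow>
           f (s1, s2) = (\<Sum>\<^sub>\<infinity>(m, n)\<in>N2. a (m, n) * of_nat m powr (- s1) * of_nat n powr (- s2))))"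

end

theory Submission
  imports
    Defs
    "HOL-Complex_Analysis.Conformal_Mappings"
    "HOL-Algebra.Group"
    "HOL-Real_Asymp.Real_Asymp"
begin

text \<open>
  The disjunction \<open>m1 dvd m2 \<or> n1 dvd n2\<close> in the definition of almost monotone weights forces
  boundedness, so every almost monotone weight is admissible and \<open>\<nu> = \<xi> = \<omega>\<close> works. It remains to
  show that \<open>\<phi> \<circ> f\<close> has an \<open>\<omega>\<close>-absolutely convergent Dirichlet series; reciprocals are the case
  \<open>\<phi> v = 1 / v\<close>.

  Following Newman's proof of Wiener's lemma, approximate \<open>f\<close> in the weighted norm by a Dirichlet
  polynomial and expand \<open>\<phi> \<circ> f\<close> as the sum over \<open>n\<close> of the \<open>n\<close>-th Taylor coefficient of \<open>\<phi>\<close>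
  at this polynomial times the \<open>n\<close>-th power of the error. By Bohr's correspondence the Dirichlet
  polynomial is a polynomial \<open>P\<close> in finitely many variables, one for each prime in each coordinate.
  Kronecker's theorem together with the minimum modulus principle shows that the values of \<open>P\<close> on
  the closed unit polydisc stay close to the closure of the range of \<open>f\<close>. Hence the Taylor
  coefficients composed with \<open>P\<close> are holomorphic on a slightly larger polydisc, and Cauchy's
  estimates against the subexponential growth of \<open>\<omega>\<close> on powers bound their weighted norms by a
  geometric sequence.
\<close>

no_notation Infinite_Set_Sum.abs_summable_on (infix "abs'_summable'_on" 50)

section \<open>Weighted character series on a monoid\<close>

lemma
  fixes f :: "'i \<Rightarrow> 'x \<Rightarrow> 'b::banach"
  assumes abs: "\<And>i. i \<in> J \<Longrightarrow> f i abs_summable_on X"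
    and row_bound: "\<And>i. i \<in> J \<Longrightarrow> (\<Sum>\<^sub>\<infinity>x\<in>X. norm (f i x)) \<le> K i" and K: "K summable_on J"
  shows abs_summable_on_TimesI: "(\<lambda>(i, x). f i x) abs_summable_on (J \<times> X)"
    and abs_summable_on_infsum: "(\<lambda>x. \<Sum>\<^sub>\<infinity>i\<in>J. f i x) abs_summable_on X"
    and infsum_norm_infsum_le: "(\<Sum>\<^sub>\<infinity>x\<in>X. norm (\<Sum>\<^sub>\<infinity>i\<in>J. f i x)) \<le> infsum K J"
proof -
  have rows: "(\<lambda>i. \<Sum>\<^sub>\<infinity>x\<in>X. norm (f i x)) summable_on J"
    using K row_bound by (rule summable_on_comparison_test) (auto intro: infsum_nonneg)
  then have "(\<lambda>i. \<Sum>\<^sub>\<infinity>x\<in>X. norm (f i x)) abs_summable_on J"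
    by (rule summable_on_iff_abs_summable_on_real[THEN iffD1])
  with abs show double: "(\<lambda>(i, x). f i x) abs_summable_on (J \<times> X)"
    by (subst Infinite_Sum.abs_summable_on_Sigma_iff) simp
  then have norm_double: "(\<lambda>(i, x). norm (f i x)) summable_on (J \<times> X)"
    by (simp add: case_prod_unfold)
  have swapped: "(\<lambda>(x, i). f i x) abs_summable_on (X \<times> J)"
    using double by (subst (asm) summable_on_swap) (simp add: case_prod_unfold)
  then have columns: "(\<lambda>x. \<Sum>\<^sub>\<infinity>i\<in>J. norm (f i x)) summable_on X"
    by (intro summable_on_Sigma_banach) (simp add: case_prod_unfold)
  have column_bound: "norm (\<Sum>\<^sub>\<infinity>i\<in>J. f i x) \<le> (\<Sum>\<^sub>\<infinity>i\<in>J. norm (f i x))" if "x \<in> X" for x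
    using swapped that
    by (subst (asm) Infinite_Sum.abs_summable_on_Sigma_iff) (auto intro: norm_infsum_bound)
  show summable: "(\<lambda>x. \<Sum>\<^sub>\<infinity>i\<in>J. f i x) abs_summable_on X"
    using columns column_bound by (rule summable_on_comparison_test) auto
  have "(\<Sum>\<^sub>\<infinity>x\<in>X. norm (\<Sum>\<^sub>\<infinity>i\<in>J. f i x)) \<le> (\<Sum>\<^sub>\<infinity>x\<in>X. \<Sum>\<^sub>\<infinity>i\<in>J. norm (f i x))"
    using summable columns column_bound by (rule infsum_mono)
  also have "\<dots> = (\<Sum>\<^sub>\<infinity>i\<in>J. \<Sum>\<^sub>\<infinity>x\<in>X. norm (f i x))"
    using infsum_swap_banach[OF norm_double] by simp
  also have "\<dots> \<le> infsum K J"
    using rows K row_bound by (rule infsum_mono)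
  finally show "(\<Sum>\<^sub>\<infinity>x\<in>X. norm (\<Sum>\<^sub>\<infinity>i\<in>J. f i x)) \<le> infsum K J" .
qed

locale weighted_characters = Group.monoid G for G (structure) +
  fixes \<omega> :: "'a \<Rightarrow> real" and D :: "'s set" and \<psi> :: "'s \<Rightarrow> 'a \<Rightarrow> complex"
  assumes weight_ge_1: "x \<in> carrier G \<Longrightarrow> 1 \<le> \<omega> x"
    and weight_mult_le: "x \<in> carrier G \<Longrightarrow> y \<in> carrier G \<Longrightarrow> \<omega> (x \<otimes> y) \<le> \<omega> x * \<omega> y"
    and char_one: "s \<in> D \<Longrightarrow> \<psi> s \<one> = 1"
    and char_mult: "s \<in> D \<Longrightarrow> x \<in> carrier G \<Longrightarrow> y \<in> carrier G \<Longrightarrow> \<psi> s (x \<otimes> y) = \<psi> s x * \<psi> s y"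
    and norm_char_le_1: "s \<in> D \<Longrightarrow> norm (\<psi> s x) \<le> 1"
begin

abbreviation weighted_summable :: "('a \<Rightarrow> complex) \<Rightarrow> bool" where
  "weighted_summable a \<equiv> (\<lambda>x. norm (a x) * \<omega> x) summable_on carrier G"

abbreviation weighted_norm :: "('a \<Rightarrow> complex) \<Rightarrow> real" where
  "weighted_norm a \<equiv> (\<Sum>\<^sub>\<infinity>x\<in>carrier G. norm (a x) * \<omega> x)"

abbreviation char_series :: "('a \<Rightarrow> complex) \<Rightarrow> 's \<Rightarrow> complex" where
  "char_series a s \<equiv> (\<Sum>\<^sub>\<infinity>x\<in>carrier G. a x * \<psi> s x)"

definition weighted_norm_le :: "real \<Rightarrow> ('s \<Rightarrow> complex) \<Rightarrow> bool" where
  "weighted_norm_le K f \<longleftrightarrow>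
     (\<exists>a. weighted_summable a \<and> weighted_norm a \<le> K \<and> (\<forall>s\<in>D. f s = char_series a s))"

lemma weighted_norm_leE:
  assumes "weighted_norm_le K f"
  obtains a where "weighted_summable a" "weighted_norm a \<le> K" "\<And>s. s \<in> D \<Longrightarrow> f s = char_series a s"
  using assms unfolding weighted_norm_le_def by blast

lemma weight_nonneg: "x \<in> carrier G \<Longrightarrow> 0 \<le> \<omega> x"
  using weight_ge_1[of x] by simp

lemma weighted_term_nonneg: "x \<in> carrier G \<Longrightarrow> 0 \<le> norm (c :: complex) * \<omega> x"
  by (simp add: weight_nonneg)

lemma char_pow: "s \<in> D \<Longrightarrow> x \<in> carrier G \<Longrightarrow> \<psi> s (x [^] (n :: nat)) = \<psi> s x ^ n"
  by (induction n) (auto simp: char_one char_mult)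

lemma weighted_norm_le_nonneg: "weighted_norm_le K f \<Longrightarrow> 0 \<le> K"
  by (elim weighted_norm_leE) (meson infsum_nonneg order_trans weighted_term_nonneg)

lemma norm_char_term_le: "s \<in> D \<Longrightarrow> x \<in> carrier G \<Longrightarrow> norm (c * \<psi> s x) \<le> norm c * \<omega> x"
  unfolding norm_mult using norm_char_le_1[of s x] weight_ge_1[of x] by (intro mult_left_mono) auto

lemma abs_summable_char_series:
  assumes "weighted_summable a" "s \<in> D"
  shows "(\<lambda>x. a x * \<psi> s x) abs_summable_on carrier G"
  using assms(1) norm_char_term_le[OF assms(2)] by (rule summable_on_comparison_test) auto

lemma norm_le_weighted_norm:
  assumes "weighted_norm_le K f" "s \<in> D"
  shows "norm (f s) \<le> K"
proof -
  obtain a where summable: "weighted_summable a" and norm_a: "weighted_norm a \<le> K"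
    and f: "\<And>s. s \<in> D \<Longrightarrow> f s = char_series a s"
    using weighted_norm_leE[OF assms(1)] by blast
  have "norm (f s) \<le> (\<Sum>\<^sub>\<infinity>x\<in>carrier G. norm (a x * \<psi> s x))"
    unfolding f[OF assms(2)] by (intro norm_infsum_bound abs_summable_char_series summable assms(2))
  also have "\<dots> \<le> weighted_norm a"
    by (intro infsum_mono abs_summable_char_series norm_char_term_le summable assms(2))
  finally show ?thesis using norm_a by simp
qed

lemma weighted_norm_le_mono: "weighted_norm_le K f \<Longrightarrow> K \<le> L \<Longrightarrow> weighted_norm_le L f"
  by (force simp: weighted_norm_le_def)

lemma weighted_norm_le_transform:
  "weighted_norm_le K f \<Longrightarrow> (\<And>s. s \<in> D \<Longrightarrow> f s = g s) \<Longrightarrow> weighted_norm_le K g"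
  by (simp add: weighted_norm_le_def)

lemma weighted_norm_le_cmult:
  assumes "weighted_norm_le K f"
  shows "weighted_norm_le (norm c * K) (\<lambda>s. c * f s)"
proof -
  obtain a where summable: "weighted_summable a" and norm_a: "weighted_norm a \<le> K"
    and f: "\<And>s. s \<in> D \<Longrightarrow> f s = char_series a s"
    using weighted_norm_leE[OF assms(1)] by blast
  show ?thesis
    unfolding weighted_norm_le_def
    using summable_on_cmult_right[OF summable, of "norm c"] norm_a f
    by (intro exI[of _ "\<lambda>x. c * a x"])
       (simp add: norm_mult mult.assoc infsum_cmult_right' mult_left_mono)
qed

lemma weighted_norm_le_char:
  assumes "x \<in> carrier G"
  shows "weighted_norm_le (\<omega> x) (\<lambda>s. \<psi> s x)"
  unfolding weighted_norm_le_def
proof (intro exI[of _ "\<lambda>y. if y = x then 1 else 0"] conjI ballI)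
  have "(\<Sum>\<^sub>\<infinity>y\<in>carrier G. norm (if y = x then 1 else 0 :: complex) * \<omega> y) = (\<Sum>\<^sub>\<infinity>y\<in>{x}. \<omega> y)"
    using assms by (intro infsum_cong_neutral) auto
  then show "(\<Sum>\<^sub>\<infinity>y\<in>carrier G. norm (if y = x then 1 else 0 :: complex) * \<omega> y) \<le> \<omega> x"
    by simp
  have "(\<lambda>y. \<omega> y) summable_on {x}" by simp
  then show "(\<lambda>y. norm (if y = x then 1 else 0 :: complex) * \<omega> y) summable_on carrier G"
    by (rule summable_on_cong_neutral[THEN iffD1, rotated -1]) (use assms in auto)
  show "\<psi> s x = (\<Sum>\<^sub>\<infinity>y\<in>carrier G. (if y = x then 1 else 0) * \<psi> s y)" for s
  proof -
    have "(\<Sum>\<^sub>\<infinity>y\<in>carrier G. (if y = x then 1 else 0) * \<psi> s y) = (\<Sum>\<^sub>\<infinity>y\<in>{x}. \<psi> s y)"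
      using assms by (intro infsum_cong_neutral) auto
    then show ?thesis by simp
  qed
qed

lemma weighted_norm_le_const: "weighted_norm_le (norm c * \<omega> \<one>) (\<lambda>s. c)"
  using weighted_norm_le_cmult[OF weighted_norm_le_char[OF one_closed], of c]
  by (rule weighted_norm_le_transform) (simp add: char_one)

lemma weighted_norm_le_infsum:
  assumes f: "\<And>i. i \<in> J \<Longrightarrow> weighted_norm_le (K i) (f i)" and K: "K summable_on J"
  shows "weighted_norm_le (infsum K J) (\<lambda>s. \<Sum>\<^sub>\<infinity>i\<in>J. f i s)"
proof -
  have "\<forall>i\<in>J. \<exists>a. weighted_summable a \<and> weighted_norm a \<le> K i \<and> (\<forall>s\<in>D. f i s = char_series a s)"
    using f unfolding weighted_norm_le_def by blast
  from bchoice[OF this] obtain a where summable: "\<And>i. i \<in> J \<Longrightarrow> weighted_summable (a i)"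
    and norm_a: "\<And>i. i \<in> J \<Longrightarrow> weighted_norm (a i) \<le> K i"
    and f_eq: "\<And>i s. i \<in> J \<Longrightarrow> s \<in> D \<Longrightarrow> f i s = char_series (a i) s"
    by blast
  define b where "b i x = a i x * complex_of_real (\<omega> x)" for i x
  have norm_b: "norm (b i x) = norm (a i x) * \<omega> x" if "x \<in> carrier G" for i x
    using weight_nonneg[OF that] by (simp add: b_def norm_mult)
  have abs_b: "b i abs_summable_on carrier G" "(\<Sum>\<^sub>\<infinity>x\<in>carrier G. norm (b i x)) \<le> K i"
    if "i \<in> J" for i
    using summable[OF that] norm_a[OF that]
    by (simp_all add: norm_b cong: summable_on_cong infsum_cong)
  have norm_infsum_b: "norm (\<Sum>\<^sub>\<infinity>i\<in>J. b i x) = norm (\<Sum>\<^sub>\<infinity>i\<in>J. a i x) * \<omega> x" if "x \<in> carrier G" for x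
    using weight_nonneg[OF that] by (simp add: b_def infsum_cmult_left' norm_mult)
  show ?thesis
    unfolding weighted_norm_le_def
  proof (intro exI[of _ "\<lambda>x. \<Sum>\<^sub>\<infinity>i\<in>J. a i x"] conjI ballI)
    show "(\<lambda>x. norm (\<Sum>\<^sub>\<infinity>i\<in>J. a i x) * \<omega> x) summable_on carrier G"
      using abs_summable_on_infsum[OF abs_b K] by (simp add: norm_infsum_b cong: summable_on_cong)
    show "(\<Sum>\<^sub>\<infinity>x\<in>carrier G. norm (\<Sum>\<^sub>\<infinity>i\<in>J. a i x) * \<omega> x) \<le> infsum K J"
      using infsum_norm_infsum_le[OF abs_b K] by (simp add: norm_infsum_b cong: infsum_cong)
    fix s assume s: "s \<in> D"
    have "(\<lambda>(i, x). a i x * \<psi> s x) abs_summable_on (J \<times> carrier G)"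
      using abs_summable_on_TimesI[OF abs_b K]
      by (rule Infinite_Sum.abs_summable_on_comparison_test)
         (use norm_char_term_le[OF s] norm_b in auto)
    then have "(\<Sum>\<^sub>\<infinity>i\<in>J. \<Sum>\<^sub>\<infinity>x\<in>carrier G. a i x * \<psi> s x) = (\<Sum>\<^sub>\<infinity>x\<in>carrier G. (\<Sum>\<^sub>\<infinity>i\<in>J. a i x) * \<psi> s x)"
      by (simp add: infsum_swap_banach abs_summable_summable infsum_cmult_left')
    then show "(\<Sum>\<^sub>\<infinity>i\<in>J. f i s) = (\<Sum>\<^sub>\<infinity>x\<in>carrier G. (\<Sum>\<^sub>\<infinity>i\<in>J. a i x) * \<psi> s x)"
      using f_eq s by (simp cong: infsum_cong)
  qed
qed

lemma weighted_norm_le_sums: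
  assumes f: "\<And>n :: nat. weighted_norm_le (K n) (f n)" and K: "K sums L"
    and g: "\<And>s. s \<in> D \<Longrightarrow> (\<lambda>n. f n s) sums g s"
  shows "weighted_norm_le L g"
proof -
  have L: "(K has_sum L) UNIV"
    using K weighted_norm_le_nonneg[OF f] by (rule sums_nonneg_imp_has_sum)
  then have "weighted_norm_le L (\<lambda>s. \<Sum>\<^sub>\<infinity>n. f n s)"
    using weighted_norm_le_infsum[where J = UNIV, OF f] by (auto simp: has_sum_iff)
  moreover have "(\<Sum>\<^sub>\<infinity>n. f n s) = g s" if s: "s \<in> D" for s
  proof (rule infsumI, rule norm_summable_imp_has_sum)
    show "summable (\<lambda>n. norm (f n s))"
      by (rule summable_comparison_test[OF _ sums_summable[OF K]])
         (use norm_le_weighted_norm[OF f s] in simp)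
  qed (rule g[OF s])
  ultimately show ?thesis
    by (rule weighted_norm_le_transform)
qed

lemma weighted_norm_le_linear_combination:
  assumes a: "weighted_summable a" "weighted_norm a \<le> K"
    and h: "\<And>x. x \<in> carrier G \<Longrightarrow> weighted_norm_le (\<omega> x * L) (h x)" and "0 \<le> L"
  shows "weighted_norm_le (K * L) (\<lambda>s. \<Sum>\<^sub>\<infinity>x\<in>carrier G. a x * h x s)"
proof (rule weighted_norm_le_mono)
  show "weighted_norm_le (\<Sum>\<^sub>\<infinity>x\<in>carrier G. norm (a x) * \<omega> x * L) (\<lambda>s. \<Sum>\<^sub>\<infinity>x\<in>carrier G. a x * h x s)"
    using weighted_norm_le_cmult[OF h] summable_on_cmult_left[OF a(1), of L]
    by (intro weighted_norm_le_infsum) (simp_all add: mult.assoc)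
  show "(\<Sum>\<^sub>\<infinity>x\<in>carrier G. norm (a x) * \<omega> x * L) \<le> K * L"
    using a(2) \<open>0 \<le> L\<close> by (simp add: infsum_cmult_left' mult_right_mono)
qed

lemma weighted_norm_le_char_mult:
  assumes "weighted_norm_le K f" and y: "y \<in> carrier G"
  shows "weighted_norm_le (\<omega> y * K) (\<lambda>s. \<psi> s y * f s)"
proof -
  obtain a where summable: "weighted_summable a" and norm_a: "weighted_norm a \<le> K"
    and f: "\<And>s. s \<in> D \<Longrightarrow> f s = char_series a s"
    using weighted_norm_leE[OF assms(1)] by blast
  have "weighted_norm_le (\<omega> x * \<omega> y) (\<lambda>s. \<psi> s (x \<otimes> y))" if "x \<in> carrier G" for x
    using weighted_norm_le_char[OF m_closed[OF that y]] weight_mult_le[OF that y]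
    by (rule weighted_norm_le_mono)
  then have "weighted_norm_le (K * \<omega> y) (\<lambda>s. \<Sum>\<^sub>\<infinity>x\<in>carrier G. a x * \<psi> s (x \<otimes> y))"
    using weight_nonneg[OF y] by (rule weighted_norm_le_linear_combination[OF summable norm_a])
  moreover have "(\<Sum>\<^sub>\<infinity>x\<in>carrier G. a x * \<psi> s (x \<otimes> y)) = \<psi> s y * f s" if "s \<in> D" for s
  proof -
    have "(\<Sum>\<^sub>\<infinity>x\<in>carrier G. a x * \<psi> s (x \<otimes> y)) = (\<Sum>\<^sub>\<infinity>x\<in>carrier G. \<psi> s y * (a x * \<psi> s x))"
      using that y by (intro infsum_cong) (simp add: char_mult)
    then show ?thesis by (simp add: infsum_cmult_right' f that)
  qed
  ultimately have "weighted_norm_le (K * \<omega> y) (\<lambda>s. \<psi> s y * f s)"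
    by (rule weighted_norm_le_transform)
  then show ?thesis by (simp only: mult.commute)
qed

lemma weighted_norm_le_mult:
  assumes "weighted_norm_le K f" and g: "weighted_norm_le L g"
  shows "weighted_norm_le (K * L) (\<lambda>s. f s * g s)"
proof -
  obtain a where summable: "weighted_summable a" and norm_a: "weighted_norm a \<le> K"
    and f: "\<And>s. s \<in> D \<Longrightarrow> f s = char_series a s"
    using weighted_norm_leE[OF assms(1)] by blast
  have "weighted_norm_le (K * L) (\<lambda>s. \<Sum>\<^sub>\<infinity>x\<in>carrier G. a x * (\<psi> s x * g s))"
    using summable norm_a weighted_norm_le_char_mult[OF g] weighted_norm_le_nonneg[OF g]
    by (rule weighted_norm_le_linear_combination)
  then show ?thesis
    by (rule weighted_norm_le_transform) (simp add: f infsum_cmult_left' flip: mult.assoc)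
qed

lemma weighted_norm_le_power:
  assumes "weighted_norm_le K f"
  shows "weighted_norm_le (K ^ n * \<omega> \<one>) (\<lambda>s. f s ^ n)"
proof (induction n)
  case 0
  show ?case using weighted_norm_le_const[of 1] by simp
next
  case (Suc n)
  show ?case using weighted_norm_le_mult[OF assms Suc] by (simp add: mult_ac)
qed

end

section \<open>Separately holomorphic functions on polydiscs\<close>

lemma Cauchy_coeff_le:
  assumes hol: "h holomorphic_on ball z R"
    and bound: "\<And>w. w \<in> ball z R \<Longrightarrow> norm (h w) \<le> M" and "0 < R"
  shows "norm ((deriv ^^ n) h z / fact n) \<le> M / R ^ n"
proof (rule tendsto_lowerbound)
  show "((\<lambda>r. M / r ^ n) \<longlongrightarrow> M / R ^ n) (at_left R)"
    using \<open>0 < R\<close> by (intro tendsto_intros) auto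
  show "\<forall>\<^sub>F r in at_left R. norm ((deriv ^^ n) h z / fact n) \<le> M / r ^ n"
    using eventually_at_left_real[OF \<open>0 < R\<close>]
  proof eventually_elim
    case (elim r)
    then have subset: "cball z r \<subseteq> ball z R" by auto
    have "norm ((deriv ^^ n) h z) \<le> fact n * M / r ^ n"
      using elim subset hol bound
      by (intro Cauchy_inequality)
         (auto simp: dist_norm
           intro: holomorphic_on_subset holomorphic_on_imp_continuous_on continuous_on_subset)
    then show ?case by (simp add: norm_divide field_simps)
  qed
qed simp

lemma norm_taylor_remainder_le:
  assumes hol: "h holomorphic_on ball 0 R" and bound: "\<And>w. w \<in> ball 0 R \<Longrightarrow> norm (h w) \<le> M"
    and "0 < R" and w: "norm w \<le> R / 2"
  shows "norm (h w - (\<Sum>m<n. (deriv ^^ m) h 0 / fact m * w ^ m)) \<le> 2 * M * (norm w / R) ^ n"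
proof -
  define q where "q = norm w / R"
  define c where "c m = (deriv ^^ m) h 0 / fact m" for m
  have q: "0 \<le> q" "q \<le> 1 / 2" using w \<open>0 < R\<close> by (auto simp: q_def field_simps)
  have "0 \<le> M"
    using norm_ge_zero bound[of 0] \<open>0 < R\<close> by (meson centre_in_ball order_trans)
  have "(\<lambda>m. c m * w ^ m) sums h w"
    using holomorphic_power_series[OF hol, of w] w \<open>0 < R\<close> by (simp add: c_def)
  then have tail: "(\<lambda>m. c (m + n) * w ^ (m + n)) sums (h w - (\<Sum>m<n. c m * w ^ m))"
    by (rule sums_split_initial_segment)
  have geometric: "(\<lambda>m. M * q ^ n * q ^ m) sums (M * q ^ n * (1 / (1 - q)))"
    using q by (intro sums_mult geometric_sums) auto
  have "norm (h w - (\<Sum>m<n. c m * w ^ m)) \<le> M * q ^ n * (1 / (1 - q))"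
  proof (rule norm_sums_le[OF tail geometric])
    fix m
    have "norm (c (m + n) * w ^ (m + n)) \<le> M / R ^ (m + n) * norm w ^ (m + n)"
      unfolding norm_mult norm_power c_def
      by (intro mult_right_mono Cauchy_coeff_le[OF hol bound \<open>0 < R\<close>]) auto
    then show "norm (c (m + n) * w ^ (m + n)) \<le> M * q ^ n * q ^ m"
      by (simp add: q_def power_divide power_add mult_ac)
  qed
  also have "\<dots> \<le> M * q ^ n * 2"
    using q \<open>0 \<le> M\<close> by (intro mult_left_mono) (auto simp: field_simps)
  finally show ?thesis by (simp add: c_def q_def)
qed

definition polydisc :: "real \<Rightarrow> 'i set \<Rightarrow> ('i \<Rightarrow> complex) set" where
  "polydisc R I = {z. \<forall>i\<in>I. norm (z i) < R}"

definition cpolydisc :: "real \<Rightarrow> 'i set \<Rightarrow> ('i \<Rightarrow> complex) set" where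
  "cpolydisc R I = {z. \<forall>i\<in>I. norm (z i) \<le> R}"

definition depends_on :: "'i set \<Rightarrow> (('i \<Rightarrow> 'a) \<Rightarrow> 'b) \<Rightarrow> bool" where
  "depends_on I F \<longleftrightarrow> (\<forall>z w. (\<forall>i\<in>I. z i = w i) \<longrightarrow> F z = F w)"

definition sep_holomorphic :: "real \<Rightarrow> 'i set \<Rightarrow> (('i \<Rightarrow> complex) \<Rightarrow> complex) \<Rightarrow> bool" where
  "sep_holomorphic R I F \<longleftrightarrow>
     (\<forall>z\<in>polydisc R I. \<forall>i\<in>I. (\<lambda>w. F (z(i := w))) holomorphic_on ball 0 R)"

definition taylor_coeff :: "'i \<Rightarrow> nat \<Rightarrow> (('i \<Rightarrow> complex) \<Rightarrow> complex) \<Rightarrow> ('i \<Rightarrow> complex) \<Rightarrow> complex" where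
  "taylor_coeff j n F z = (deriv ^^ n) (\<lambda>w. F (z(j := w))) 0 / fact n"

lemma polydisc_upd: "z \<in> polydisc R I \<Longrightarrow> norm w < R \<Longrightarrow> z(i := w) \<in> polydisc R (insert i I)"
  by (simp add: polydisc_def)

lemma depends_onD: "depends_on I F \<Longrightarrow> (\<And>i. i \<in> I \<Longrightarrow> z i = w i) \<Longrightarrow> F z = F w"
  by (simp add: depends_on_def)

lemma depends_on_comp: "depends_on I F \<Longrightarrow> depends_on I (\<lambda>z. h (F z))"
  unfolding depends_on_def by metis

lemma sep_holomorphicD:
  "sep_holomorphic R I F \<Longrightarrow> z \<in> polydisc R I \<Longrightarrow> i \<in> I \<Longrightarrow> (\<lambda>w. F (z(i := w))) holomorphic_on ball 0 R"
  by (simp add: sep_holomorphic_def)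

lemma sep_holomorphic_comp:
  assumes F: "sep_holomorphic R I F" and h: "h holomorphic_on V"
    and FV: "\<And>z. z \<in> polydisc R I \<Longrightarrow> F z \<in> V"
  shows "sep_holomorphic R I (\<lambda>z. h (F z))"
  unfolding sep_holomorphic_def
proof (intro ballI)
  fix z i assume z: "z \<in> polydisc R I" and i: "i \<in> I"
  have "(\<lambda>w. F (z(i := w))) ` ball 0 R \<subseteq> V"
    using FV polydisc_upd[OF z, of _ i] i by (auto simp: insert_absorb)
  then show "(\<lambda>w. h (F (z(i := w)))) holomorphic_on ball 0 R"
    using holomorphic_on_compose_gen[OF sep_holomorphicD[OF F z i] h] by (simp add: o_def)
qed

lemma depends_on_taylor_coeff:
  assumes "depends_on (insert j I) F"
  shows "depends_on I (taylor_coeff j n F)"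
  unfolding depends_on_def
proof (intro allI impI)
  fix z w :: "'a \<Rightarrow> complex" assume "\<forall>i\<in>I. z i = w i"
  then have "(\<lambda>v. F (z(j := v))) = (\<lambda>v. F (w(j := v)))"
    by (intro ext depends_onD[OF assms]) auto
  then show "taylor_coeff j n F z = taylor_coeff j n F w" by (simp add: taylor_coeff_def)
qed

definition taylor_quotient ::
    "'i \<Rightarrow> nat \<Rightarrow> complex \<Rightarrow> (('i \<Rightarrow> complex) \<Rightarrow> complex) \<Rightarrow> ('i \<Rightarrow> complex) \<Rightarrow> complex" where
  "taylor_quotient j n w F z = (F (z(j := w)) - (\<Sum>m<n. taylor_coeff j m F z * w ^ m)) / w ^ n"

context
  fixes F :: "('i \<Rightarrow> complex) \<Rightarrow> complex" and R M :: real and j :: 'i and I :: "'i set"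
  assumes F: "sep_holomorphic R (insert j I) F"
    and bound: "\<And>z. z \<in> polydisc R (insert j I) \<Longrightarrow> norm (F z) \<le> M"
    and R: "0 < R" and j: "j \<notin> I"
begin

lemma holomorphic_on_slice: "z \<in> polydisc R I \<Longrightarrow> (\<lambda>w. F (z(j := w))) holomorphic_on ball 0 R"
  using sep_holomorphicD[OF F polydisc_upd[of z R I 0 j], of j] R by simp

lemma norm_slice_le: "z \<in> polydisc R I \<Longrightarrow> w \<in> ball 0 R \<Longrightarrow> norm (F (z(j := w))) \<le> M"
  by (intro bound polydisc_upd) auto

lemma norm_taylor_coeff_le:
  assumes "z \<in> polydisc R I"
  shows "norm (taylor_coeff j n F z) \<le> M / R ^ n"
  unfolding taylor_coeff_def
  by (intro Cauchy_coeff_le holomorphic_on_slice norm_slice_le assms R)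

lemma norm_taylor_quotient_diff_le:
  assumes z: "z \<in> polydisc R I" and w: "w \<noteq> 0" "norm w \<le> R / 2"
  shows "norm (taylor_quotient j n w F z - taylor_coeff j n F z) \<le> 2 * M / R ^ Suc n * norm w"
proof -
  have "taylor_quotient j n w F z - taylor_coeff j n F z
      = (F (z(j := w)) - (\<Sum>m<Suc n. taylor_coeff j m F z * w ^ m)) / w ^ n"
    using w by (simp add: taylor_quotient_def field_simps)
  also have "norm \<dots> \<le> 2 * M * (norm w / R) ^ Suc n / norm w ^ n"
    unfolding norm_divide norm_power taylor_coeff_def
    by (intro divide_right_mono norm_taylor_remainder_le holomorphic_on_slice norm_slice_le z R w)
       auto
  also have "\<dots> = 2 * M / R ^ Suc n * norm w"
    using w by (simp add: power_divide)
  finally show ?thesis .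
qed

lemma holomorphic_on_taylor_quotient:
  assumes lower: "\<And>m. m < n \<Longrightarrow> sep_holomorphic R I (taylor_coeff j m F)"
    and z: "z \<in> polydisc R I" and i: "i \<in> I" and w: "w \<noteq> 0" "norm w < R"
  shows "(\<lambda>v. taylor_quotient j n w F (z(i := v))) holomorphic_on ball 0 R"
proof -
  have "(\<lambda>v. F ((z(j := w))(i := v))) holomorphic_on ball 0 R"
    using z w i by (intro sep_holomorphicD[OF F] polydisc_upd) auto
  moreover have "(z(j := w))(i := v) = z(i := v, j := w)" for v
    using i j by (intro fun_upd_twist) auto
  ultimately show ?thesis
    unfolding taylor_quotient_def
    using w by (auto intro!: holomorphic_intros sep_holomorphicD[OF lower z i])
qed

text \<open>Each coefficient is a uniform limit of difference quotients built from the preceding ones.\<close>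

lemma sep_holomorphic_taylor_coeff: "sep_holomorphic R I (taylor_coeff j n F)"
proof (induction n rule: less_induct)
  case (less n)
  show ?case
    unfolding sep_holomorphic_def
  proof (intro ballI)
    fix z i assume z: "z \<in> polydisc R I" and i: "i \<in> I"
    define w :: "nat \<Rightarrow> complex" where "w k = of_real (R / (real k + 2))" for k
    have norm_w: "norm (w k) = R / (real k + 2)" for k
      unfolding w_def norm_of_real using R by simp
    have w: "w k \<noteq> 0" "norm (w k) \<le> R / 2" for k
      using R norm_w[of k] by (auto simp: field_simps)
    let ?c = "\<lambda>v. taylor_coeff j n F (z(i := v))"
    let ?q = "\<lambda>k v. taylor_quotient j n (w k) F (z(i := v))"
    have q: "?q k holomorphic_on ball 0 R" for k
      using w[of k] R by (intro holomorphic_on_taylor_quotient less z i) auto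
    have zv: "z(i := v) \<in> polydisc R I" if "v \<in> ball 0 R" for v
      using polydisc_upd[OF z, of v i] that i by (simp add: insert_absorb)
    have error_tendsto_0: "(\<lambda>k. 2 * M / R ^ Suc n * norm (w k)) \<longlonglongrightarrow> 0"
      unfolding norm_w by real_asymp
    have uniform: "uniform_limit (ball 0 R) ?q ?c sequentially"
    proof (rule uniform_limitI)
      fix e :: real assume "0 < e"
      then have "\<forall>\<^sub>F k in sequentially. 2 * M / R ^ Suc n * norm (w k) < e"
        by (rule order_tendstoD(2)[OF error_tendsto_0])
      then show "\<forall>\<^sub>F k in sequentially. \<forall>v\<in>ball 0 R. dist (?q k v) (?c v) < e"
        by eventually_elim
           (auto simp only: dist_norm
             intro: le_less_trans[OF norm_taylor_quotient_diff_le[OF zv w]])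
    qed
    show "?c holomorphic_on ball 0 R"
    proof (rule holomorphic_uniform_sequence[OF open_ball q])
      fix x :: complex assume "x \<in> ball 0 R"
      then obtain d where "0 < d" "cball x d \<subseteq> ball 0 R"
        by (metis open_contains_cball open_ball)
      then show "\<exists>d>0. cball x d \<subseteq> ball 0 R \<and> uniform_limit (cball x d) ?q ?c sequentially"
        using uniform_limit_on_subset[OF uniform] by blast
    qed
  qed
qed

end

section \<open>Substituting characters into holomorphic functions\<close>

context weighted_characters
begin

lemma weighted_norm_le_power_series:
  assumes x: "x \<in> carrier G" and growth: "\<And>n. \<omega> (x [^] n) \<le> C * Q ^ n" and Q: "0 < Q" "Q < R"
    and coeffs: "\<And>n :: nat. weighted_norm_le (B / R ^ n) (c n)"
    and g: "\<And>s. s \<in> D \<Longrightarrow> (\<lambda>n. c n s * \<psi> s x ^ n) sums g s"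
  shows "weighted_norm_le (B * (C / (1 - Q / R))) g"
proof (rule weighted_norm_le_sums[OF _ _ g])
  have "0 \<le> B" using weighted_norm_le_nonneg[OF coeffs[of 0]] by simp
  show "weighted_norm_le (B * C * (Q / R) ^ n) (\<lambda>s. c n s * \<psi> s x ^ n)" for n
  proof (rule weighted_norm_le_mono)
    have "weighted_norm_le (B / R ^ n * \<omega> (x [^] n)) (\<lambda>s. c n s * \<psi> s (x [^] n))"
      by (intro weighted_norm_le_mult coeffs weighted_norm_le_char nat_pow_closed x)
    then show "weighted_norm_le (B / R ^ n * \<omega> (x [^] n)) (\<lambda>s. c n s * \<psi> s x ^ n)"
      by (rule weighted_norm_le_transform) (simp add: char_pow x)
    have "B / R ^ n * \<omega> (x [^] n) \<le> B / R ^ n * (C * Q ^ n)"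
      using \<open>0 \<le> B\<close> Q by (intro mult_left_mono growth) auto
    then show "B / R ^ n * \<omega> (x [^] n) \<le> B * C * (Q / R) ^ n"
      by (simp add: power_divide mult_ac)
  qed
  have "(\<lambda>n. B * C * (Q / R) ^ n) sums (B * C * (1 / (1 - Q / R)))"
    using Q by (intro sums_mult geometric_sums) auto
  then show "(\<lambda>n. B * C * (Q / R) ^ n) sums (B * (C / (1 - Q / R)))" by simp
qed

lemma weighted_norm_le_sep_holomorphic:
  assumes "finite I" "I \<subseteq> carrier G"
    and growth: "\<And>x n. x \<in> I \<Longrightarrow> \<omega> (x [^] (n :: nat)) \<le> C * Q ^ n"
    and Q: "0 < Q" "Q < R" and R: "1 < R"
    and F: "sep_holomorphic R I F" "depends_on I F" "\<And>z. z \<in> polydisc R I \<Longrightarrow> norm (F z) \<le> M"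
  shows "weighted_norm_le (M * \<omega> \<one> * (C / (1 - Q / R)) ^ card I) (\<lambda>s. F (\<psi> s))"
  using assms(1,2) growth F
proof (induction I arbitrary: F M rule: finite_induct)
  case empty
  have "(\<lambda>s. F (\<psi> s)) = (\<lambda>s. F (\<lambda>_. 0))"
    by (intro ext depends_onD[OF empty.prems(4)]) simp
  moreover have "weighted_norm_le (M * \<omega> \<one>) (\<lambda>s. F (\<lambda>_. 0))"
    using empty.prems(5) weight_nonneg[OF one_closed]
    by (intro weighted_norm_le_mono[OF weighted_norm_le_const] mult_right_mono)
       (auto simp: polydisc_def)
  ultimately show ?case by simp
next
  case (insert j I)
  have j: "j \<in> carrier G" and "0 < R" using insert.prems(1) R by auto
  have coeff: "weighted_norm_le (M * \<omega> \<one> * (C / (1 - Q / R)) ^ card I / R ^ n)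
      (\<lambda>s. taylor_coeff j n F (\<psi> s))" for n
  proof -
    have "weighted_norm_le (M / R ^ n * \<omega> \<one> * (C / (1 - Q / R)) ^ card I)
        (\<lambda>s. taylor_coeff j n F (\<psi> s))"
      using insert.prems(1,2,4)
        sep_holomorphic_taylor_coeff[OF insert.prems(3,5) \<open>0 < R\<close> insert.hyps(2)]
        norm_taylor_coeff_le[OF insert.prems(3,5) \<open>0 < R\<close> insert.hyps(2)]
      by (intro insert.IH depends_on_taylor_coeff) auto
    then show ?thesis by simp
  qed
  have "(\<lambda>n. taylor_coeff j n F (\<psi> s) * \<psi> s j ^ n) sums F (\<psi> s)" if s: "s \<in> D" for s
  proof -
    have small: "norm (\<psi> s x) < R" for x using norm_char_le_1[OF s, of x] R by simp
    then have "(\<lambda>w. F ((\<psi> s)(j := w))) holomorphic_on ball 0 R"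
      by (intro sep_holomorphicD[OF insert.prems(3)]) (auto simp: polydisc_def)
    from holomorphic_power_series[OF this, of "\<psi> s j"] show ?thesis
      by (simp add: taylor_coeff_def small)
  qed
  from weighted_norm_le_power_series[OF j _ Q coeff this]
  show ?case using insert.prems(2) insert.hyps by (simp add: mult_ac)
qed

lemma weighted_norm_le_taylor_series:
  assumes B: "\<And>n. weighted_norm_le (B / (2 * \<rho>) ^ n) (\<lambda>s. (deriv ^^ n) \<phi> (g s) / fact n)"
    and diff: "weighted_norm_le \<rho> (\<lambda>s. f s - g s)" and "0 < \<rho>"
    and \<phi>: "\<And>s. s \<in> D \<Longrightarrow> \<phi> holomorphic_on ball (g s) (2 * \<rho>)"
  shows "weighted_norm_le (2 * B * \<omega> \<one>) (\<lambda>s. \<phi> (f s))"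
proof (rule weighted_norm_le_sums)
  fix n
  have "weighted_norm_le (B / (2 * \<rho>) ^ n * (\<rho> ^ n * \<omega> \<one>))
      (\<lambda>s. (deriv ^^ n) \<phi> (g s) / fact n * (f s - g s) ^ n)"
    by (intro weighted_norm_le_mult B weighted_norm_le_power diff)
  moreover have "B / (2 * \<rho>) ^ n * (\<rho> ^ n * \<omega> \<one>) = B * \<omega> \<one> * (1 / 2) ^ n"
    using \<open>0 < \<rho>\<close> by (simp add: field_simps)
  ultimately show "weighted_norm_le (B * \<omega> \<one> * (1 / 2) ^ n)
      (\<lambda>s. (deriv ^^ n) \<phi> (g s) / fact n * (f s - g s) ^ n)" by simp
next
  have "(\<lambda>n. B * \<omega> \<one> * (1 / 2 :: real) ^ n) sums (B * \<omega> \<one> * (1 / (1 - 1 / 2)))"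
    by (intro sums_mult geometric_sums) simp
  then show "(\<lambda>n. B * \<omega> \<one> * (1 / 2) ^ n) sums (2 * B * \<omega> \<one>)" by (simp add: mult_ac)
next
  fix s assume s: "s \<in> D"
  have "f s \<in> ball (g s) (2 * \<rho>)"
    using norm_le_weighted_norm[OF diff s] \<open>0 < \<rho>\<close> by (simp add: dist_norm norm_minus_commute)
  then show "(\<lambda>n. (deriv ^^ n) \<phi> (g s) / fact n * (f s - g s) ^ n) sums \<phi> (f s)"
    by (rule holomorphic_power_series[OF \<phi>[OF s]])
qed

end

section \<open>Closed polydiscs\<close>

lemma minimum_modulus_cball:
  fixes h :: "complex \<Rightarrow> complex"
  assumes hol: "h holomorphic_on UNIV" and nz: "\<And>v. v \<in> cball 0 r \<Longrightarrow> h v \<noteq> 0"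
    and "0 < k" and sphere: "\<And>v. norm v = r \<Longrightarrow> k \<le> norm (h v)" and w: "w \<in> cball 0 r"
  shows "k \<le> norm (h w)"
proof (cases "r = 0")
  case True
  with w sphere show ?thesis by auto
next
  case False
  have "0 < r"
    using w False norm_ge_zero[of w] by (simp del: norm_ge_zero)
  have hol_on: "h holomorphic_on T" for T
    using hol by (rule holomorphic_on_subset) simp
  have "norm (1 / h w) \<le> 1 / k"
  proof (rule maximum_modulus_frontier[of "\<lambda>v. 1 / h v" "cball 0 r"])
    show "(\<lambda>v. 1 / h v) holomorphic_on interior (cball 0 r)"
      using nz by (intro holomorphic_intros hol_on) auto
    show "continuous_on (closure (cball 0 r)) (\<lambda>v. 1 / h v)"
      using nz by (intro continuous_intros holomorphic_on_imp_continuous_on hol_on) auto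
    show "norm (1 / h v) \<le> 1 / k" if "v \<in> frontier (cball 0 r)" for v
      using sphere[of v] that \<open>0 < k\<close> \<open>0 < r\<close> by (simp add: norm_divide frac_le)
  qed (use w in auto)
  then show ?thesis
    using nz[OF w] \<open>0 < k\<close> by (simp add: norm_divide field_simps)
qed

lemma minimum_modulus_polydisc:
  fixes G :: "('i \<Rightarrow> complex) \<Rightarrow> complex" and r :: "'i \<Rightarrow> real"
  assumes "finite I" and hol: "\<And>z i. (\<lambda>w. G (z(i := w))) holomorphic_on UNIV"
    and nz: "\<And>z. (\<And>i. i \<in> I \<Longrightarrow> norm (z i) \<le> r i) \<Longrightarrow> G z \<noteq> 0" and "0 < k"
    and torus: "\<And>z. (\<And>i. i \<in> I \<Longrightarrow> norm (z i) = r i) \<Longrightarrow> k \<le> norm (G z)"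
    and z: "\<And>i. i \<in> I \<Longrightarrow> norm (z i) \<le> r i"
  shows "k \<le> norm (G z)"
proof -
  have "k \<le> norm (G z)"
    if "finite J" "J \<subseteq> I" "\<And>i. i \<in> I \<Longrightarrow> norm (z i) \<le> r i" "\<And>i. i \<in> I - J \<Longrightarrow> norm (z i) = r i" for z J
    using that
  proof (induction J arbitrary: z rule: finite_induct)
    case empty
    then show ?case by (intro torus) auto
  next
    case (insert j J)
    have "k \<le> norm (G (z(j := z j)))"
    proof (rule minimum_modulus_cball[OF hol _ \<open>0 < k\<close>])
      show "G (z(j := w)) \<noteq> 0" if "w \<in> cball 0 (r j)" for w
        using that insert.prems(2) by (intro nz) auto
      show "k \<le> norm (G (z(j := w)))" if "norm w = r j" for w
        using that insert.prems by (intro insert.IH) auto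
      show "z j \<in> cball 0 (r j)" using insert.prems(1,2) by simp
    qed
    then show ?case by simp
  qed
  from this[OF \<open>finite I\<close> subset_refl z] show ?thesis by simp
qed

lemma compact_cpolydisc: "compact (cpolydisc R (UNIV :: 'i set))"
proof -
  let ?B = "PiE (UNIV :: 'i set) (\<lambda>_. cball (0 :: complex) R)"
  have "compactin (product_topology (\<lambda>_. euclidean) UNIV) ?B"
    by (simp add: compactin_PiE)
  moreover have "?B = cpolydisc R UNIV"
    by (auto simp: cpolydisc_def)
  ultimately show ?thesis
    by (simp add: euclidean_product_topology)
qed

definition dilate :: "'i set \<Rightarrow> ('i \<Rightarrow> real) \<Rightarrow> ('i \<Rightarrow> complex) \<Rightarrow> 'i \<Rightarrow> complex" where
  "dilate I r z i = (if i \<in> I then of_real (r i) * z i else 0)"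

lemma continuous_on_dilate:
  assumes "\<And>i. i \<in> I \<Longrightarrow> continuous_on T (\<lambda>t. r t i)"
  shows "continuous_on (T \<times> UNIV) (\<lambda>(t, z). dilate I (r t) z)"
  unfolding case_prod_unfold
proof (rule continuous_on_coordinatewise_then_product)
  fix i
  show "continuous_on (T \<times> UNIV) (\<lambda>p. dilate I (r (fst p)) (snd p) i)"
  proof (cases "i \<in> I")
    case True
    have "continuous_on (T \<times> UNIV) (\<lambda>p. r (fst p) i)"
      by (rule continuous_on_compose2[OF assms[OF True]]) (auto intro: continuous_intros)
    moreover have "continuous_on (T \<times> UNIV) (\<lambda>p. snd p i :: complex)"
      by (rule continuous_on_compose2[OF continuous_on_product_coordinates])
         (auto intro: continuous_intros)
    ultimately show ?thesis
      using True by (auto simp: dilate_def intro: continuous_intros)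
  qed (simp add: dilate_def)
qed

lemma dilate_cpolydisc_divide:
  assumes "depends_on I G" and r: "\<And>i. i \<in> I \<Longrightarrow> 0 < r i" and z: "\<And>i. i \<in> I \<Longrightarrow> norm (z i) \<le> r i * R"
    and "0 \<le> R"
  obtains w where "w \<in> cpolydisc R UNIV" "G z = G (dilate I r w)"
proof
  let ?w = "\<lambda>i. if i \<in> I then z i / of_real (r i) else 0"
  show "?w \<in> cpolydisc R UNIV"
    using z \<open>0 \<le> R\<close> r by (force simp: cpolydisc_def norm_divide pos_divide_le_eq mult.commute)
  have "z i = dilate I r ?w i" if "i \<in> I" for i
    using r[OF that] that by (simp add: dilate_def)
  then show "G z = G (dilate I r ?w)"
    by (rule depends_onD[OF assms(1)])
qed

context
  fixes G :: "('i \<Rightarrow> complex) \<Rightarrow> complex" and I :: "'i set" and r :: "real \<Rightarrow> 'i \<Rightarrow> real" and k :: real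
  assumes I: "finite I" and G: "depends_on I G" "continuous_on UNIV G"
    and hol: "\<And>z i. (\<lambda>w. G (z(i := w))) holomorphic_on UNIV"
    and r: "\<And>i. i \<in> I \<Longrightarrow> continuous_on {0..1} (\<lambda>t. r t i)"
      "\<And>i. i \<in> I \<Longrightarrow> r 0 i = 0" "\<And>i. i \<in> I \<Longrightarrow> r 1 i = 1"
      "\<And>t i. i \<in> I \<Longrightarrow> 0 < t \<Longrightarrow> t \<le> 1 \<Longrightarrow> 0 < r t i"
    and "0 < k"
    and torus: "\<And>t z. 0 < t \<Longrightarrow> t \<le> 1 \<Longrightarrow> (\<And>i. i \<in> I \<Longrightarrow> norm (z i) = r t i) \<Longrightarrow> k \<le> norm (G z)"
begin

lemma zero_free_dilation_lower_bound:
  assumes t: "0 < t" "t \<le> 1" and nz: "\<And>w. w \<in> cpolydisc 1 UNIV \<Longrightarrow> G (dilate I (r t) w) \<noteq> 0"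
    and z: "\<And>i. i \<in> I \<Longrightarrow> norm (z i) \<le> r t i"
  shows "k \<le> norm (G z)"
proof (rule minimum_modulus_polydisc[OF I hol _ \<open>0 < k\<close> torus[OF t] z])
  fix z :: "'i \<Rightarrow> complex" assume "\<And>i. i \<in> I \<Longrightarrow> norm (z i) \<le> r t i"
  then obtain w where "w \<in> cpolydisc 1 UNIV" "G z = G (dilate I (r t) w)"
    using dilate_cpolydisc_divide[of I G "r t" z 1] G(1) r(4) t by auto
  then show "G z \<noteq> 0" using nz by simp
qed

lemma continuous_on_dilation: "continuous_on ({0..1} \<times> UNIV) (\<lambda>(t, z). G (dilate I (r t) z))"
  using continuous_on_compose2[OF G(2) continuous_on_dilate[OF r(1)]]
  by (simp add: case_prod_unfold)

lemma continuous_on_norm_dilation: "continuous_on {0..1} (\<lambda>t. norm (G (dilate I (r t) z)))"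
  by (intro continuous_on_norm
        continuous_on_compose2[OF continuous_on_dilation, of _ "\<lambda>t. (t, z)", simplified])
     (auto intro: continuous_intros)

lemma dilation_lower_bound_closure:
  assumes "0 < u" "u \<le> 1" "t \<in> {0..u}"
    and "\<And>t. 0 < t \<Longrightarrow> t < u \<Longrightarrow> k \<le> norm (G (dilate I (r t) z))"
  shows "k \<le> norm (G (dilate I (r t) z))"
  using assms continuous_on_subset[OF continuous_on_norm_dilation, of "{0..u}" z]
  by (intro continuous_ge_on_closure[of "{0<..<u}" "\<lambda>t. norm (G (dilate I (r t) z))" t k]) auto

lemma first_zero_of_dilations:
  assumes "t \<in> {0..1}" "w \<in> cpolydisc 1 UNIV" "G (dilate I (r t) w) = 0"
  obtains t0 w0 where "t0 \<in> {0..1}" "w0 \<in> cpolydisc 1 UNIV" "G (dilate I (r t0) w0) = 0"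
    "\<And>t w. 0 < t \<Longrightarrow> t < t0 \<Longrightarrow> w \<in> cpolydisc 1 UNIV \<Longrightarrow> G (dilate I (r t) w) \<noteq> 0"
proof -
  let ?K = "{0..1 :: real} \<times> cpolydisc 1 (UNIV :: 'i set)"
  define Z where "Z = ?K \<inter> (\<lambda>(t, z). G (dilate I (r t) z)) -` {0}"
  have "continuous_on ?K (\<lambda>(t, z). G (dilate I (r t) z))"
    by (rule continuous_on_subset[OF continuous_on_dilation]) auto
  then have "closedin (top_of_set ?K) Z"
    unfolding Z_def by (rule continuous_closedin_preimage) simp
  then have "compact Z"
    by (rule closedin_compact[rotated]) (intro compact_Times compact_cpolydisc compact_Icc)
  moreover have "(t, w) \<in> Z" using assms by (simp add: Z_def)
  then have "Z \<noteq> {}" by blast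
  ultimately have "\<exists>p\<in>Z. \<forall>q\<in>Z. fst p \<le> fst q"
    by (rule continuous_attains_inf) (intro continuous_intros)
  then obtain t0 w0 where zero: "(t0, w0) \<in> Z" and first: "\<And>q. q \<in> Z \<Longrightarrow> t0 \<le> fst q" by force
  show thesis
  proof (rule that)
    show "t0 \<in> {0..1}" "w0 \<in> cpolydisc 1 UNIV" "G (dilate I (r t0) w0) = 0"
      using zero by (auto simp: Z_def)
    then show "G (dilate I (r t) w) \<noteq> 0" if "0 < t" "t < t0" "w \<in> cpolydisc 1 UNIV" for t w
      using first[of "(t, w)"] that by (auto simp: Z_def)
  qed
qed

text \<open>Up to the first zero the minimum modulus is attained on the distinguished boundary, so the
  lower bound \<open>k\<close> persists in the limit and excludes that zero.\<close>

lemma zero_free_dilations: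
  assumes "t \<in> {0..1}" "w \<in> cpolydisc 1 UNIV"
  shows "G (dilate I (r t) w) \<noteq> 0"
proof
  assume "G (dilate I (r t) w) = 0"
  then obtain t0 w0 where t0: "t0 \<in> {0..1}"
    and w0: "w0 \<in> cpolydisc 1 UNIV" "G (dilate I (r t0) w0) = 0"
    and minimal: "\<And>t w. 0 < t \<Longrightarrow> t < t0 \<Longrightarrow> w \<in> cpolydisc 1 UNIV \<Longrightarrow> G (dilate I (r t) w) \<noteq> 0"
    using first_zero_of_dilations[OF assms] by blast
  have "k \<le> norm (G (dilate I (r t0) w0))"
  proof (cases "t0 = 0")
    case True
    have "k \<le> norm (G (dilate I (r 0) (\<lambda>_. 1)))"
    proof (rule dilation_lower_bound_closure[of 1])
      fix t :: real assume "0 < t" "t < 1"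
      then show "k \<le> norm (G (dilate I (r t) (\<lambda>_. 1)))"
        by (intro torus[of t]) (auto simp: dilate_def r(4) abs_of_pos)
    qed auto
    also have "G (dilate I (r 0) (\<lambda>_. 1)) = G (dilate I (r t0) w0)"
      using r(2) True by (intro depends_onD[OF G(1)]) (simp add: dilate_def)
    finally show ?thesis .
  next
    case False
    show ?thesis
    proof (rule dilation_lower_bound_closure[of t0])
      fix t assume "0 < t" "t < t0"
      then show "k \<le> norm (G (dilate I (r t) w0))"
        using t0 w0(1) minimal
        by (intro zero_free_dilation_lower_bound[of t])
           (auto simp: dilate_def cpolydisc_def norm_mult abs_of_pos mult_left_le r(4) less_imp_le)
    qed (use t0 False in auto)
  qed
  with w0(2) \<open>0 < k\<close> show False by simp
qed

lemma polydisc_lower_bound: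
  assumes z: "z \<in> cpolydisc 1 I"
  shows "k \<le> norm (G z)"
  using z
  by (intro zero_free_dilation_lower_bound[of 1] zero_free_dilations)
     (auto simp: cpolydisc_def r(3))

end

lemma polydisc_enlarge:
  assumes "depends_on I P" "continuous_on UNIV P" "open W" and P: "\<And>z. z \<in> cpolydisc R I \<Longrightarrow> P z \<in> W"
    and "0 < R"
  obtains S where "R < S" "\<And>z. z \<in> polydisc S I \<Longrightarrow> P z \<in> W"
proof -
  have "continuous_on (UNIV \<times> UNIV) (\<lambda>(t, z). dilate I (\<lambda>_. t) z)"
    by (intro continuous_on_dilate continuous_intros)
  then have "continuous_on UNIV (\<lambda>(t, z). P (dilate I (\<lambda>_. t) z))"
    using continuous_on_compose2[OF assms(2)] by (simp add: case_prod_unfold)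
  then have open_vimage: "open ((\<lambda>(t, z). P (dilate I (\<lambda>_. t) z)) -` W)"
    using assms(3) by (intro open_vimage)
  have "P (dilate I (\<lambda>_. 1) z) \<in> W" if "z \<in> cpolydisc R UNIV" for z
    using that \<open>0 < R\<close> by (intro P) (auto simp: cpolydisc_def dilate_def)
  then have "{1} \<times> cpolydisc R UNIV \<subseteq> (\<lambda>(t, z). P (dilate I (\<lambda>_. t) z)) -` W" by auto
  from Elementary_Topology.tube_lemma[OF compact_cpolydisc open_vimage this]
  obtain T where "1 \<in> T" "open T"
    and T: "T \<times> cpolydisc R UNIV \<subseteq> (\<lambda>(t, z). P (dilate I (\<lambda>_. t) z)) -` W"
    by blast
  then obtain e where e: "0 < e" "cball 1 e \<subseteq> T" using open_contains_cball by blast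
  show thesis
  proof (rule that[of "(1 + e) * R"])
    show "R < (1 + e) * R" using e(1) \<open>0 < R\<close> by simp
    fix z assume z: "z \<in> polydisc ((1 + e) * R) I"
    then have "norm (z i) \<le> (1 + e) * R" if "i \<in> I" for i
      using that by (simp add: polydisc_def less_imp_le)
    then obtain w where w: "w \<in> cpolydisc R UNIV" "P z = P (dilate I (\<lambda>_. 1 + e) w)"
      using dilate_cpolydisc_divide[OF assms(1), of "\<lambda>_. 1 + e" z R] e(1) \<open>0 < R\<close> by auto
    have "1 + e \<in> T" using e by (auto simp: dist_norm)
    then have "(1 + e, w) \<in> (\<lambda>(t, z). P (dilate I (\<lambda>_. t) z)) -` W" using w(1) T by blast
    then show "P z \<in> W" using w(2) by simp
  qed
qed

lemma tendsto_fun_componentwise: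
  fixes f :: "'n \<Rightarrow> 'i \<Rightarrow> 'a::topological_space"
  assumes "\<And>i. ((\<lambda>n. f n i) \<longlongrightarrow> l i) F"
  shows "(f \<longlongrightarrow> l) F"
proof -
  have "limitin (product_topology (\<lambda>_. euclidean) UNIV) f l F"
    using assms by (simp add: limitin_componentwise)
  then show ?thesis by (simp add: euclidean_product_topology)
qed

lemma closed_mem_coordinatewise_limit:
  fixes P :: "('i \<Rightarrow> 'a::real_normed_vector) \<Rightarrow> 'b::topological_space"
  assumes P: "depends_on I P" "continuous_on UNIV P" and "closed C"
    and approx: "\<And>e. 0 < e \<Longrightarrow> \<exists>w. P w \<in> C \<and> (\<forall>i\<in>I. norm (w i - z i) < e)"
  shows "P z \<in> C"
proof -
  have "\<forall>n. \<exists>w. P w \<in> C \<and> (\<forall>i\<in>I. norm (w i - z i) < inverse (real (Suc n)))"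
    using approx by simp
  then obtain w where w: "\<And>n. P (w n) \<in> C"
    "\<And>n i. i \<in> I \<Longrightarrow> norm (w n i - z i) < inverse (real (Suc n))"
    by metis
  define v where "v n i = (if i \<in> I then w n i else z i)" for n i
  have "(\<lambda>n. v n i) \<longlonglongrightarrow> z i" for i
  proof (cases "i \<in> I")
    case True
    have "\<forall>\<^sub>F n in sequentially. norm (w n i - z i) \<le> inverse (real (Suc n))"
      using w(2)[OF True] by (simp add: less_imp_le)
    then have "(\<lambda>n. w n i - z i) \<longlonglongrightarrow> 0"
      by (rule Lim_null_comparison[OF _ LIMSEQ_inverse_real_of_nat])
    then show ?thesis using True by (simp add: v_def LIM_zero_iff)
  qed (simp add: v_def)
  then have "v \<longlonglongrightarrow> z" by (rule tendsto_fun_componentwise)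
  then have lim: "(\<lambda>n. P (v n)) \<longlonglongrightarrow> P z"
    by (intro continuous_on_tendsto_compose[OF P(2)]) auto
  have "P (v n) \<in> C" for n
    using w(1)[of n] depends_onD[OF P(1), of "v n" "w n"] by (simp add: v_def)
  then show ?thesis
    using lim by (rule closed_sequentially[OF \<open>closed C\<close>])
qed

section \<open>Polynomial functions of finitely many coordinates\<close>

inductive_set polyfuns :: "'i set \<Rightarrow> (('i \<Rightarrow> complex) \<Rightarrow> complex) set" for I where
  const: "(\<lambda>_. c) \<in> polyfuns I"
| coord: "i \<in> I \<Longrightarrow> (\<lambda>z. z i) \<in> polyfuns I"
| add: "P \<in> polyfuns I \<Longrightarrow> Q \<in> polyfuns I \<Longrightarrow> (\<lambda>z. P z + Q z) \<in> polyfuns I"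
| mult: "P \<in> polyfuns I \<Longrightarrow> Q \<in> polyfuns I \<Longrightarrow> (\<lambda>z. P z * Q z) \<in> polyfuns I"

lemma polyfuns_sum: "(\<And>x. x \<in> S \<Longrightarrow> P x \<in> polyfuns I) \<Longrightarrow> (\<lambda>z. \<Sum>x\<in>S. P x z) \<in> polyfuns I"
  by (induction S rule: infinite_finite_induct) (auto intro: polyfuns.intros)

lemma polyfuns_mono: "P \<in> polyfuns I \<Longrightarrow> I \<subseteq> J \<Longrightarrow> P \<in> polyfuns J"
  by (induction rule: polyfuns.induct) (auto intro: polyfuns.intros)

lemma polyfuns_finite_support:
  assumes "P \<in> polyfuns I"
  obtains J where "finite J" "J \<subseteq> I" "P \<in> polyfuns J"
proof -
  have common: "\<exists>J. finite J \<and> J \<subseteq> I \<and> P \<in> polyfuns J \<and> Q \<in> polyfuns J"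
    if "\<exists>J. finite J \<and> J \<subseteq> I \<and> P \<in> polyfuns J" "\<exists>J. finite J \<and> J \<subseteq> I \<and> Q \<in> polyfuns J"
    for P Q
    using that by (meson finite_UnI le_sup_iff polyfuns_mono sup_ge1 sup_ge2)
  have "\<exists>J. finite J \<and> J \<subseteq> I \<and> P \<in> polyfuns J"
    using assms
  proof induction
    case (const c)
    then show ?case by (blast intro: polyfuns.const)
  next
    case (coord i)
    then show ?case by (intro exI[of _ "{i}"]) (auto intro: polyfuns.coord)
  next
    case (add P Q)
    then show ?case using common[OF add.IH] by (blast intro: polyfuns.add)
  next
    case (mult P Q)
    then show ?case using common[OF mult.IH] by (blast intro: polyfuns.mult)
  qed
  then show thesis using that by blast
qed

lemma depends_on_polyfuns: "P \<in> polyfuns I \<Longrightarrow> depends_on I P"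
  by (induction rule: polyfuns.induct) (auto simp: depends_on_def, metis+)

lemma continuous_on_polyfuns: "P \<in> polyfuns I \<Longrightarrow> continuous_on UNIV P"
  by (induction rule: polyfuns.induct) (auto intro: continuous_intros)

lemma holomorphic_on_polyfuns_slice:
  assumes "P \<in> polyfuns I"
  shows "(\<lambda>w. P (z(i := w))) holomorphic_on A"
  using assms
proof induction
  case (coord j)
  then show ?case by (cases "j = i") (auto intro: holomorphic_intros)
qed (auto intro: holomorphic_intros)

lemma sep_holomorphic_polyfuns: "P \<in> polyfuns I \<Longrightarrow> sep_holomorphic R I P"
  by (simp add: sep_holomorphic_def holomorphic_on_polyfuns_slice)

section \<open>Holomorphic functional calculus\<close>

lemma geometric_bound_of_root_tendsto:
  fixes a :: "nat \<Rightarrow> real"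
  assumes a: "\<And>n. 0 \<le> a n" and lim: "(\<lambda>n. a n powr (1 / real n)) \<longlonglongrightarrow> l" and "l < Q"
  obtains C where "0 \<le> C" "\<And>n. a n \<le> C * Q ^ n"
proof -
  have "0 \<le> l" by (rule tendsto_lowerbound[OF lim]) auto
  then have "0 < Q" using \<open>l < Q\<close> by simp
  have "\<forall>\<^sub>F n in sequentially. norm (a n / Q ^ n) \<le> norm (1 :: real)"
    using order_tendstoD(2)[OF lim \<open>l < Q\<close>] eventually_gt_at_top[of 0]
  proof eventually_elim
    case (elim n)
    have "a n = (a n powr (1 / real n)) ^ n"
      using elim a[of n] by (cases "a n = 0") (auto simp: powr_powr simp flip: powr_realpow)
    also have "\<dots> \<le> Q ^ n"
      using elim by (intro power_mono) auto
    finally show ?case using a[of n] \<open>0 < Q\<close> by simp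
  qed
  then have "Bseq (\<lambda>n. a n / Q ^ n)"
    by (rule Bseq_eventually_mono) simp
  then obtain C where "0 < C" "\<And>n. norm (a n / Q ^ n) \<le> C" by (auto elim: BseqE)
  then show thesis
    using a \<open>0 < Q\<close> by (intro that[of C]) (auto simp: field_simps)
qed

lemma bounded_near_compact:
  fixes \<phi> :: "'a::heine_borel \<Rightarrow> 'b::real_normed_vector"
  assumes Y: "compact Y" "Y \<noteq> {}" "Y \<subseteq> U" and "open U" and \<phi>: "continuous_on U \<phi>"
  obtains e M where "0 < e" "{v. infdist v Y < e} \<subseteq> U" "\<And>v. infdist v Y < e \<Longrightarrow> norm (\<phi> v) \<le> M"
proof -
  obtain e where e: "0 < e" "{v. infdist v Y \<le> e} \<subseteq> U"
    using compact_in_open_separated[OF Y(2,1) \<open>open U\<close> Y(3)] .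
  have "compact {v. infdist v Y \<le> e}" using Y e by (intro compact_infdist_le) auto
  then have "compact (\<phi> ` {v. infdist v Y \<le> e})"
    using e(2) by (intro compact_continuous_image continuous_on_subset[OF \<phi>])
  then obtain M where M: "\<And>v. infdist v Y \<le> e \<Longrightarrow> norm (\<phi> v) \<le> M"
    using compact_imp_bounded by (force simp: bounded_iff)
  show thesis by (rule that[of e M]) (use e M in auto)
qed

context weighted_characters
begin

lemma weighted_norm_le_truncation:
  assumes a: "weighted_summable a"
    and f: "\<And>s. s \<in> D \<Longrightarrow> f s = char_series a s" and "0 < \<rho>"
  obtains S where "finite S" "S \<subseteq> carrier G" "weighted_norm_le \<rho> (\<lambda>s. f s - (\<Sum>x\<in>S. a x * \<psi> s x))"
proof -
  obtain S where S: "finite S" "S \<subseteq> carrier G"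
    and close: "dist (\<Sum>x\<in>S. norm (a x) * \<omega> x) (weighted_norm a) \<le> \<rho>"
    using infsum_finite_approximation[OF a \<open>0 < \<rho>\<close>] by blast
  define b where "b x = (if x \<in> S then 0 else a x)" for x
  have "weighted_norm b = (\<Sum>\<^sub>\<infinity>x\<in>carrier G - S. norm (a x) * \<omega> x)"
    by (intro infsum_cong_neutral) (auto simp: b_def)
  also have "\<dots> \<le> \<rho>"
    using close by (simp add: infsum_Diff[OF a summable_on_finite[OF S(1)] S(2)] S(1) dist_real_def)
  finally have norm_b: "weighted_norm b \<le> \<rho>" .
  have "weighted_summable b"
    using a by (rule summable_on_comparison_test) (auto simp: b_def weight_nonneg)
  moreover have "f s - (\<Sum>x\<in>S. a x * \<psi> s x) = char_series b s" if s: "s \<in> D" for s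
  proof -
    have "char_series b s = (\<Sum>\<^sub>\<infinity>x\<in>carrier G - S. a x * \<psi> s x)"
      by (intro infsum_cong_neutral) (auto simp: b_def)
    also have "\<dots> = f s - (\<Sum>x\<in>S. a x * \<psi> s x)"
      using infsum_Diff[OF abs_summable_summable[OF abs_summable_char_series[OF a s]]
          summable_on_finite[OF S(1)] S(2)]
      by (simp add: f[OF s] S(1))
    finally show ?thesis ..
  qed
  ultimately have "weighted_norm_le \<rho> (\<lambda>s. f s - (\<Sum>x\<in>S. a x * \<psi> s x))"
    unfolding weighted_norm_le_def using norm_b by blast
  with S show thesis by (rule that)
qed

lemma weighted_norm_le_compose_near_polyfun:
  assumes "finite I" "I \<subseteq> carrier G" and P: "P \<in> polyfuns I"
    and growth: "\<And>Q. 1 < Q \<Longrightarrow> \<exists>C. \<forall>x\<in>I. \<forall>n. \<omega> (x [^] (n :: nat)) \<le> C * Q ^ n"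
    and diff: "weighted_norm_le \<rho> (\<lambda>s. f s - P (\<psi> s))" and "0 < \<rho>"
    and "open W" and PW: "\<And>z. z \<in> cpolydisc 1 I \<Longrightarrow> P z \<in> W"
    and \<phi>: "\<phi> holomorphic_on U" "open U" "\<And>v. v \<in> U \<Longrightarrow> norm (\<phi> v) \<le> M"
    and WU: "\<And>v. v \<in> W \<Longrightarrow> ball v (2 * \<rho>) \<subseteq> U"
  shows "\<exists>L. weighted_norm_le L (\<phi> \<circ> f)"
proof -
  obtain R where R: "1 < R" and PR: "\<And>z. z \<in> polydisc R I \<Longrightarrow> P z \<in> W"
    using polydisc_enlarge[OF depends_on_polyfuns[OF P] continuous_on_polyfuns[OF P]
        \<open>open W\<close> PW zero_less_one]
    by blast
  define Q where "Q = (1 + R) / 2"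
  have Q: "1 < Q" "0 < Q" "Q < R" using R by (auto simp: Q_def)
  obtain C where C: "\<And>x n. x \<in> I \<Longrightarrow> \<omega> (x [^] (n :: nat)) \<le> C * Q ^ n"
    using growth[OF Q(1)] by blast
  define c where "c n v = (deriv ^^ n) \<phi> v / fact n" for n v
  have "W \<subseteq> U" using WU \<open>0 < \<rho>\<close> by force
  have "c n holomorphic_on U" for n
    unfolding c_def using \<phi>(1,2) by (intro holomorphic_intros) auto
  then have "sep_holomorphic R I (\<lambda>z. c n (P z))" for n
    using PR \<open>W \<subseteq> U\<close> by (intro sep_holomorphic_comp[OF sep_holomorphic_polyfuns[OF P]]) auto
  moreover have "norm (c n (P z)) \<le> M / (2 * \<rho>) ^ n" if "z \<in> polydisc R I" for n z
    unfolding c_def using WU[OF PR[OF that]] \<phi>(3) \<open>0 < \<rho>\<close>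
    by (intro Cauchy_coeff_le holomorphic_on_subset[OF \<phi>(1)]) auto
  ultimately have coeff: "weighted_norm_le (M / (2 * \<rho>) ^ n * \<omega> \<one> * (C / (1 - Q / R)) ^ card I)
      (\<lambda>s. c n (P (\<psi> s)))" for n
    using Q(2,3) R C assms(1,2)
    by (intro weighted_norm_le_sep_holomorphic depends_on_comp[OF depends_on_polyfuns[OF P]])
  have "P (\<psi> s) \<in> W" if "s \<in> D" for s
    using norm_char_le_1[OF that] by (intro PW) (simp add: cpolydisc_def)
  then have "weighted_norm_le (2 * (M * \<omega> \<one> * (C / (1 - Q / R)) ^ card I) * \<omega> \<one>) (\<lambda>s. \<phi> (f s))"
    using coeff WU
    by (intro weighted_norm_le_taylor_series[OF _ diff \<open>0 < \<rho>\<close>] holomorphic_on_subset[OF \<phi>(1)])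
       (simp_all add: c_def)
  then show ?thesis by (auto simp: o_def)
qed

end

text \<open>The last assumption says that the closed polydisc lies in the spectrum of the polynomials in
  the characters; for Dirichlet series this is Bohr's correspondence.\<close>

locale polynomially_generated_characters = weighted_characters G \<omega> D \<psi>
  for G (structure) and \<omega> :: "'a \<Rightarrow> real" and D :: "'s set" and \<psi> :: "'s \<Rightarrow> 'a \<Rightarrow> complex" +
  fixes E :: "'a set"
  assumes gens_closed: "E \<subseteq> carrier G"
    and char_polyfun: "x \<in> carrier G \<Longrightarrow> \<exists>P\<in>polyfuns E. \<forall>s\<in>D. P (\<psi> s) = \<psi> s x"
    and weight_pow_root_tendsto: "x \<in> E \<Longrightarrow> (\<lambda>n. \<omega> (x [^] n) powr (1 / real n)) \<longlonglongrightarrow> 1"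
    and polyfun_lower_bound: "finite I \<Longrightarrow> I \<subseteq> E \<Longrightarrow> P \<in> polyfuns I \<Longrightarrow> 0 < k \<Longrightarrow>
      (\<And>s. s \<in> D \<Longrightarrow> k \<le> norm (P (\<psi> s))) \<Longrightarrow> z \<in> cpolydisc 1 I \<Longrightarrow> k \<le> norm (P z)"
begin

lemma domain_nonempty: "D \<noteq> {}"
  using polyfun_lower_bound[of "{}" "\<lambda>_. 0" 1] by (auto intro: polyfuns.const simp: cpolydisc_def)

lemma polyfun_approximation:
  assumes "weighted_norm_le K f" "0 < \<rho>"
  obtains I P where "finite I" "I \<subseteq> E" "P \<in> polyfuns I" "weighted_norm_le \<rho> (\<lambda>s. f s - P (\<psi> s))"
proof -
  obtain a where a: "weighted_summable a" and f: "\<And>s. s \<in> D \<Longrightarrow> f s = char_series a s"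
    using weighted_norm_leE[OF assms(1)] by metis
  obtain S where "finite S" and S: "S \<subseteq> carrier G"
    and approx: "weighted_norm_le \<rho> (\<lambda>s. f s - (\<Sum>x\<in>S. a x * \<psi> s x))"
    using weighted_norm_le_truncation[OF a f assms(2)] .
  obtain m where m: "\<And>x. x \<in> S \<Longrightarrow> m x \<in> polyfuns E" "\<And>x s. x \<in> S \<Longrightarrow> s \<in> D \<Longrightarrow> m x (\<psi> s) = \<psi> s x"
    using char_polyfun S by (metis subsetD)
  define P where "P z = (\<Sum>x\<in>S. a x * m x z)" for z
  have "P \<in> polyfuns E"
    unfolding P_def using m(1) by (intro polyfuns_sum polyfuns.mult polyfuns.const)
  then obtain I where I: "finite I" "I \<subseteq> E" "P \<in> polyfuns I"
    by (rule polyfuns_finite_support)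
  have "weighted_norm_le \<rho> (\<lambda>s. f s - P (\<psi> s))"
    using approx by (rule weighted_norm_le_transform) (simp add: P_def m(2))
  with I show thesis by (rule that)
qed

lemma weight_pow_growth:
  assumes "finite I" "I \<subseteq> E" "1 < Q"
  shows "\<exists>C. \<forall>x\<in>I. \<forall>n. \<omega> (x [^] (n :: nat)) \<le> C * Q ^ n"
proof -
  have "\<exists>C. 0 \<le> C \<and> (\<forall>n. \<omega> (x [^] (n :: nat)) \<le> C * Q ^ n)" if "x \<in> I" for x
  proof (rule geometric_bound_of_root_tendsto[OF _ weight_pow_root_tendsto \<open>1 < Q\<close>])
    show "x \<in> E" using that assms(2) by blast
    then show "0 \<le> \<omega> (x [^] n)" for n :: nat using gens_closed by (intro weight_nonneg) auto
  qed blast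
  then obtain C where C: "\<And>x. x \<in> I \<Longrightarrow> 0 \<le> C x" "\<And>x n. x \<in> I \<Longrightarrow> \<omega> (x [^] (n :: nat)) \<le> C x * Q ^ n"
    by metis
  have "\<omega> (x [^] n) \<le> sum C I * Q ^ n" if "x \<in> I" for x and n :: nat
  proof -
    have "C x * Q ^ n \<le> sum C I * Q ^ n"
      using that C(1) assms by (intro mult_right_mono member_le_sum) auto
    with C(2)[OF that] show ?thesis by (rule order_trans)
  qed
  then show ?thesis by blast
qed

lemma infdist_polyfun_le:
  assumes "finite I" "I \<subseteq> E" and P: "P \<in> polyfuns I"
    and diff: "weighted_norm_le \<rho> (\<lambda>s. f s - P (\<psi> s))" and z: "z \<in> cpolydisc 1 I"
  shows "infdist (P z) (closure (f ` D)) \<le> \<rho>"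
proof (rule ccontr)
  define k where "k = infdist (P z) (closure (f ` D)) - \<rho>"
  assume "\<not> ?thesis"
  then have "0 < k" by (simp add: k_def)
  have "k \<le> norm (P z + - 1 * P z)"
  proof (rule polyfun_lower_bound[OF assms(1,2) _ \<open>0 < k\<close> _ z, of "\<lambda>w. P z + - 1 * P w"])
    show "(\<lambda>w. P z + - 1 * P w) \<in> polyfuns I"
      by (intro polyfuns.intros P)
    fix s assume s: "s \<in> D"
    have "infdist (P z) (closure (f ` D)) \<le> dist (P z) (f s)"
      using s by (intro infdist_le closure_subset[THEN subsetD]) auto
    also have "\<dots> \<le> norm (P z - P (\<psi> s)) + norm (f s - P (\<psi> s))"
      using norm_triangle_ineq4[of "P z - P (\<psi> s)" "f s - P (\<psi> s)"] by (simp add: dist_norm)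
    finally show "k \<le> norm (P z + - 1 * P (\<psi> s))"
      using norm_le_weighted_norm[OF diff s] by (simp add: k_def)
  qed
  with \<open>0 < k\<close> show False by simp
qed

theorem weighted_norm_le_holomorphic_compose:
  assumes f: "weighted_norm_le K f" and \<phi>: "\<phi> holomorphic_on U"
    and U: "open U" "closure (f ` D) \<subseteq> U"
  shows "\<exists>L. weighted_norm_le L (\<phi> \<circ> f)"
proof -
  define near where "near r = {v. infdist v (closure (f ` D)) < r}" for r
  have open_near: "open (near r)" for r
    unfolding near_def by (intro open_Collect_less continuous_on_infdist continuous_intros)
  have "bounded (f ` D)"
    using norm_le_weighted_norm[OF f] by (auto simp: bounded_iff)
  then have "compact (closure (f ` D))" "closure (f ` D) \<noteq> {}"
    using domain_nonempty by (auto simp: compact_closure)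
  from bounded_near_compact[OF this U(2,1) holomorphic_on_imp_continuous_on[OF \<phi>]]
  obtain e M where "0 < e" and near_e: "near e \<subseteq> U" "\<And>v. v \<in> near e \<Longrightarrow> norm (\<phi> v) \<le> M"
    unfolding near_def mem_Collect_eq by metis
  define \<rho> where "\<rho> = e / 4"
  have "0 < \<rho>" using \<open>0 < e\<close> by (simp add: \<rho>_def)
  obtain I P where I: "finite I" "I \<subseteq> E" and P: "P \<in> polyfuns I"
    and diff: "weighted_norm_le \<rho> (\<lambda>s. f s - P (\<psi> s))"
    using polyfun_approximation[OF f \<open>0 < \<rho>\<close>] .
  show ?thesis
  proof (rule weighted_norm_le_compose_near_polyfun[OF I(1) _ P weight_pow_growth[OF I] diff \<open>0 < \<rho>\<close>
        open_near _ holomorphic_on_subset[OF \<phi> near_e(1)] open_near near_e(2)])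
    show "I \<subseteq> carrier G" using I(2) gens_closed by blast
    show "P z \<in> near (2 * \<rho>)" if "z \<in> cpolydisc 1 I" for z
      using infdist_polyfun_le[OF I P diff that] \<open>0 < \<rho>\<close> by (simp add: near_def)
    show "ball v (2 * \<rho>) \<subseteq> near e" if "v \<in> near (2 * \<rho>)" for v
    proof
      fix w assume "w \<in> ball v (2 * \<rho>)"
      then show "w \<in> near e"
        using that infdist_triangle[of w "closure (f ` D)" v]
        by (simp add: near_def \<rho>_def dist_commute)
    qed
  qed
qed

end

section \<open>Kronecker approximation by prime powers\<close>

lemma ln_prod_powers:
  assumes "finite A" "\<And>p. p \<in> A \<Longrightarrow> 0 < (p :: nat)"
  shows "ln (real (\<Prod>p\<in>A. p ^ k p)) = (\<Sum>p\<in>A. real (k p) * ln (real p))"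
proof -
  have "ln (real (\<Prod>p\<in>A. p ^ k p)) = (\<Sum>p\<in>A. ln (real p ^ k p))"
    unfolding of_nat_prod of_nat_power using assms by (intro ln_prod) simp_all
  also have "\<dots> = (\<Sum>p\<in>A. real (k p) * ln (real p))"
    using assms(2) by (intro sum.cong) (simp_all add: ln_realpow)
  finally show ?thesis .
qed

lemma sum_ln_primes_eq_0:
  assumes A: "finite A" "\<And>p. p \<in> A \<Longrightarrow> prime (p :: nat)"
    and sum: "(\<Sum>p\<in>A. of_int (k p) * ln (real p)) = 0" and "q \<in> A"
  shows "k q = 0"
proof -
  define pos neg where "pos p = nat (k p)" and "neg p = nat (- k p)" for p
  have prod_pos: "0 < (\<Prod>p\<in>A. p ^ l p)" for l :: "nat \<Rightarrow> nat"
    using A(2) by (intro prod_pos) (auto simp: prime_gt_0_nat)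
  have "real_of_int (k p) = real (pos p) - real (neg p)" for p
    by (auto simp: pos_def neg_def)
  then have "(\<Sum>p\<in>A. real (pos p) * ln (real p)) = (\<Sum>p\<in>A. real (neg p) * ln (real p))"
    using sum by (simp add: left_diff_distrib sum_subtractf)
  then have "ln (real (\<Prod>p\<in>A. p ^ pos p)) = ln (real (\<Prod>p\<in>A. p ^ neg p))"
    using ln_prod_powers[OF A(1)] A(2) by (simp only: prime_gt_0_nat)
  then have "(\<Prod>p\<in>A. p ^ pos p) = (\<Prod>p\<in>A. p ^ neg p)"
    using prod_pos by (simp only: ln_inj_iff of_nat_0_less_iff of_nat_eq_iff)
  then have "pos q = neg q"
    using multiplicity_prod_prime_powers[OF A(1), of q] A \<open>q \<in> A\<close> by metis
  then show ?thesis by (simp add: pos_def neg_def)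
qed

lemma independent_ln_primes:
  "module.independent (\<lambda>r. (*) (real_of_int r)) ((\<lambda>p :: nat. ln (real p)) ` {p. prime p})"
proof -
  interpret Modules.module "(\<lambda>r. (*) (real_of_int r))"
    by (simp add: Modules.module.intro distrib_left mult.commute)
  have inj: "inj_on (\<lambda>p :: nat. ln (real p)) {p. prime p}"
    by (auto simp: inj_on_def prime_gt_0_nat)
  show ?thesis
    unfolding independent_explicit_module
  proof (intro allI impI)
    fix T u v assume T: "finite T" "T \<subseteq> (\<lambda>p :: nat. ln (real p)) ` {p. prime p}"
      "(\<Sum>v\<in>T. real_of_int (u v) * v) = 0" "v \<in> T"
    obtain A where A: "A \<subseteq> {p. prime p}" "T = (\<lambda>p. ln (real p)) ` A"
      using T(2) by (rule subset_imageE)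
    have inj_A: "inj_on (\<lambda>p. ln (real p)) A" using inj A(1) by (rule inj_on_subset)
    obtain q where "q \<in> A" "v = ln (real q)" using T(4) A(2) by blast
    moreover have "(\<Sum>p\<in>A. real_of_int (u (ln (real p))) * ln (real p)) = 0"
      using T(3) by (simp add: A(2) sum.reindex[OF inj_A])
    moreover have "finite A" using T(1) A(2) finite_imageD[OF _ inj_A] by simp
    ultimately show "u v = 0"
      using sum_ln_primes_eq_0[of A "\<lambda>p. u (ln (real p))" q] A(1) by auto
  qed
qed

lemma norm_cis_diff_le: "norm (cis x - cis y) \<le> \<bar>x - y\<bar>"
proof -
  have "cis x - cis y = cis y * (exp (\<i> * of_real (x - y)) - 1)"
    by (simp only: right_diff_distrib cis_mult mult_1_right flip: cis_conv_exp) simp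
  then have "norm (cis x - cis y) = 2 * \<bar>sin ((x - y) / 2)\<bar>"
    by (simp only: norm_mult norm_cis dist_exp_i_1)
  also have "\<dots> \<le> \<bar>x - y\<bar>"
    using abs_sin_x_le_abs_x[of "(x - y) / 2"] by simp
  finally show ?thesis .
qed

lemma Kronecker_cis:
  fixes \<theta> :: "'a \<Rightarrow> real" and u :: "'a \<Rightarrow> complex"
  assumes "finite A" and inj: "inj_on \<theta> A"
    and indep: "module.independent (\<lambda>r. (*) (real_of_int r)) (\<theta> ` A)"
    and u: "\<And>x. x \<in> A \<Longrightarrow> norm (u x) = 1" and "0 < e"
  obtains t where "\<And>x. x \<in> A \<Longrightarrow> norm (cis (t * \<theta> x) - u x) < e"
proof -
  obtain h where h: "bij_betw h {..<card A} A"
    using ex_bij_betw_nat_finite[OF \<open>finite A\<close>] by (auto simp: atLeast0LessThan)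
  then have "(\<theta> \<circ> h) ` {..<card A} = \<theta> ` A" "inj_on (\<theta> \<circ> h) {..<card A}"
    using inj by (simp_all only: bij_betw_def image_comp[symmetric] comp_inj_on)
  then obtain t m where approx: "\<And>i. i < card A \<Longrightarrow>
      \<bar>t * (\<theta> \<circ> h) i - of_int (m i) - Arg (u (h i)) / (2 * pi)\<bar> < e / (2 * pi)"
    using Kronecker_thm_1[of "\<theta> \<circ> h" "card A" "e / (2 * pi)" "\<lambda>i. Arg (u (h i)) / (2 * pi)"]
      indep \<open>0 < e\<close>
    by (metis divide_pos_pos pi_gt_zero zero_less_mult_iff zero_less_numeral)
  show thesis
  proof (rule that[of "2 * pi * t"])
    fix x assume x: "x \<in> A"
    then obtain i where i: "i < card A" "x = h i" using h by (auto simp: bij_betw_def)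
    have "cis (2 * pi * t * \<theta> x) = cis (2 * pi * t * \<theta> x - 2 * pi * of_int (m i))"
      by (simp add: cis_multiple_2pi flip: cis_divide)
    moreover have "u x = cis (Arg (u x))"
      using cis_Arg[of "u x"] u[OF x] by (cases "u x = 0") (auto simp: sgn_eq)
    ultimately have "norm (cis (2 * pi * t * \<theta> x) - u x)
        \<le> \<bar>2 * pi * t * \<theta> x - 2 * pi * of_int (m i) - Arg (u x)\<bar>"
      using norm_cis_diff_le by metis
    also have "\<dots> = 2 * pi * \<bar>t * (\<theta> \<circ> h) i - of_int (m i) - Arg (u (h i)) / (2 * pi)\<bar>"
      by (simp add: i(2) field_simps flip: abs_mult)
    also have "\<dots> < e"
      using approx[OF i(1)] by (simp add: field_simps)
    finally show "norm (cis (2 * pi * t * \<theta> x) - u x) < e" .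
  qed
qed

lemma of_nat_powr_Complex:
  assumes "0 < (n :: nat)"
  shows "(of_nat n :: complex) powr (- Complex \<sigma> \<tau>) =
    of_real (real n powr (- \<sigma>)) * cis (- \<tau> * ln (real n))"
proof -
  have "(of_nat n :: complex) powr (- Complex \<sigma> \<tau>) = exp (- Complex \<sigma> \<tau> * of_real (ln (real n)))"
    using assms by (simp add: powr_def Ln_of_nat)
  also have "\<dots> = of_real (exp (- \<sigma> * ln (real n))) * cis (- \<tau> * ln (real n))"
    by (subst exp_eq_polar) simp
  finally show ?thesis using assms by (simp add: powr_def)
qed

lemma prime_powers_dense_in_torus:
  assumes A: "finite A" "\<And>p. p \<in> A \<Longrightarrow> prime (p :: nat)" and "0 \<le> \<sigma>"
    and z: "\<And>p. p \<in> A \<Longrightarrow> norm (z p) = real p powr (- \<sigma>)" and "0 < e"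
  obtains s where "Re s = \<sigma>" "\<And>p. p \<in> A \<Longrightarrow> norm ((of_nat p :: complex) powr (- s) - z p) < e"
proof -
  let ?r = "\<lambda>p :: nat. real p powr (- \<sigma>)"
  define u where "u p = z p / of_real (?r p)" for p
  have r: "0 < ?r p" "?r p \<le> 1" if "p \<in> A" for p
    using A(2)[OF that, THEN prime_ge_1_nat] \<open>0 \<le> \<sigma>\<close> powr_mono[of "- \<sigma>" 0 "real p"] by auto
  have u: "norm (u p) = 1" "z p = of_real (?r p) * u p" if "p \<in> A" for p
    using r[OF that] z[OF that] by (auto simp: u_def norm_divide)
  interpret Modules.module "(\<lambda>r. (*) (real_of_int r))"
    by (simp add: Modules.module.intro distrib_left mult.commute)
  have "independent ((\<lambda>p. ln (real p)) ` A)"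
    using A(2) by (intro independent_mono[OF independent_ln_primes]) auto
  moreover have "inj_on (\<lambda>p. ln (real p)) A"
    using A(2) by (auto simp: inj_on_def prime_gt_0_nat)
  ultimately obtain t where t: "\<And>p. p \<in> A \<Longrightarrow> norm (cis (t * ln (real p)) - u p) < e"
    using Kronecker_cis[where u = u, OF A(1) _ _ u(1) \<open>0 < e\<close>] by blast
  show thesis
  proof (rule that[of "Complex \<sigma> (- t)"])
    fix p assume p: "p \<in> A"
    let ?diff = "(of_nat p :: complex) powr (- Complex \<sigma> (- t)) - z p"
    have "?diff = of_real (?r p) * (cis (t * ln (real p)) - u p)"
      using u(2)[OF p] A(2)[OF p, THEN prime_gt_0_nat] of_nat_powr_Complex[of p \<sigma> "- t"]
      by (simp add: right_diff_distrib)
    then have "norm ?diff = ?r p * norm (cis (t * ln (real p)) - u p)"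
      using r(1)[OF p] by (simp add: norm_mult)
    also have "\<dots> \<le> 1 * norm (cis (t * ln (real p)) - u p)"
      using r(2)[OF p] by (rule mult_right_mono) simp
    also have "\<dots> < e" using t[OF p] by simp
    finally show "norm ?diff < e" .
  qed simp
qed

section \<open>Dirichlet series in two variables\<close>

definition N2_monoid :: "(nat \<times> nat) monoid" where
  "N2_monoid = \<lparr>carrier = N2, mult = (\<lambda>x y. (fst x * fst y, snd x * snd y)), one = (1, 1)\<rparr>"

definition dchar :: "complex \<times> complex \<Rightarrow> nat \<times> nat \<Rightarrow> complex" where
  "dchar s x = of_nat (fst x) powr (- fst s) * of_nat (snd x) powr (- snd s)"

definition prime_gens :: "(nat \<times> nat) set" where
  "prime_gens = {(p, 1) |p. prime p} \<union> {(1, p) |p. prime p}"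

lemma N2_monoid_simps [simp]:
  "carrier N2_monoid = N2"
  "x \<otimes>\<^bsub>N2_monoid\<^esub> y = (fst x * fst y, snd x * snd y)"
  "\<one>\<^bsub>N2_monoid\<^esub> = (1, 1)"
  by (simp_all add: N2_monoid_def)

lemma N2_monoid_pow: "x [^]\<^bsub>N2_monoid\<^esub> (n :: nat) = (fst x ^ n, snd x ^ n)"
  by (induction n) (simp_all add: mult.commute)

lemma monoid_N2: "Group.monoid N2_monoid"
  by unfold_locales (auto simp: N2_def)

lemma of_nat_mult_powr: "(of_nat (m * n) :: complex) powr s = of_nat m powr s * of_nat n powr s"
  using powr_times_real[of "of_nat m" "of_nat n" s] by simp

lemma dchar_mult: "dchar s (fst x * fst y, snd x * snd y) = dchar s x * dchar s y"
  by (simp add: dchar_def of_nat_mult_powr del: of_nat_mult)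

lemma norm_of_nat_powr_le_1:
  assumes "0 \<le> Re s"
  shows "norm ((of_nat n :: complex) powr (- s)) \<le> 1"
proof (cases "n = 0")
  case False
  then have "norm ((of_nat n :: complex) powr (- s)) = real n powr (- Re s)"
    using norm_powr_real_powr[of "of_nat n" "- s"] by simp
  also have "\<dots> \<le> real n powr 0"
    using False assms by (intro powr_mono) auto
  finally show ?thesis using False by simp
qed simp

lemma norm_dchar_le_1: "s \<in> Hplane \<times> Hplane \<Longrightarrow> norm (dchar s x) \<le> 1"
  by (auto simp: dchar_def Hplane_def norm_mult intro!: mult_le_one norm_of_nat_powr_le_1)

lemma weighted_characters_N2:
  assumes "is_weight \<omega>"
  shows "weighted_characters N2_monoid \<omega> (Hplane \<times> Hplane) dchar"
  using assms
  by (auto simp: weighted_characters_def weighted_characters_axioms_def monoid_N2 is_weight_def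
      dchar_mult norm_dchar_le_1 simp flip: One_nat_def) (simp_all add: dchar_def)

lemma has_weighted_dirichlet_iff:
  assumes "is_weight \<omega>"
  shows "has_weighted_dirichlet \<omega> f \<longleftrightarrow>
    (\<exists>K. weighted_characters.weighted_norm_le N2_monoid \<omega> (Hplane \<times> Hplane) dchar K f)"
  unfolding has_weighted_dirichlet_def dchar_def
    weighted_characters.weighted_norm_le_def[OF weighted_characters_N2[OF assms]]
  by (auto simp: case_prod_unfold mult.assoc)

lemma polyfun_dchar_of_multiplicative:
  assumes one: "g 1 = (1, 1)"
    and mult: "\<And>m n. g (m * n) = (fst (g m) * fst (g n), snd (g m) * snd (g n))"
    and gens: "\<And>p. prime p \<Longrightarrow> g p \<in> prime_gens" and "0 < (n :: nat)"
  shows "\<exists>P\<in>polyfuns prime_gens. \<forall>s. P (dchar s) = dchar s (g n)"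
  using \<open>0 < n\<close>
proof (induction n rule: prime_divisors_induct)
  case zero
  then show ?case by simp
next
  case (unit n)
  then have "g n = (1, 1)" using one by simp
  then show ?case by (intro bexI[OF _ polyfuns.const[of 1]]) (simp add: dchar_def)
next
  case (factor p n)
  then obtain P where P: "P \<in> polyfuns prime_gens" "\<And>s. P (dchar s) = dchar s (g n)" by auto
  have "dchar s (g p) * P (dchar s) = dchar s (g (p * n))" for s
    by (simp add: P(2) mult dchar_mult)
  then show ?case
    by (intro bexI[OF _ polyfuns.mult[OF polyfuns.coord[OF gens[OF factor(1)]] P(1)]]) simp
qed

lemma dchar_polyfun:
  assumes "x \<in> N2"
  shows "\<exists>P\<in>polyfuns prime_gens. \<forall>s. P (dchar s) = dchar s x"
proof -
  obtain m n where x: "x = (m, n)" "0 < m" "0 < n" using assms by (auto simp: N2_def)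
  obtain P where P: "P \<in> polyfuns prime_gens" "\<And>s. P (dchar s) = dchar s (m, 1)"
    using polyfun_dchar_of_multiplicative[of "\<lambda>m. (m, 1)" m] x(2) by (auto simp: prime_gens_def)
  obtain Q where Q: "Q \<in> polyfuns prime_gens" "\<And>s. Q (dchar s) = dchar s (1, n)"
    using polyfun_dchar_of_multiplicative[of "\<lambda>n. (1, n)" n] x(3) by (auto simp: prime_gens_def)
  have "P (dchar s) * Q (dchar s) = dchar s x" for s
    using dchar_mult[of s "(m, 1)" "(1, n)"] P(2) Q(2) x(1) by simp
  then show ?thesis by (intro bexI[OF _ polyfuns.mult[OF P(1) Q(1)]]) simp
qed

lemma dchar_dense_in_torus:
  assumes I: "finite I" "I \<subseteq> prime_gens" and "0 \<le> \<sigma>"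
    and z: "\<And>i. i \<in> I \<Longrightarrow> norm (z i) = real (fst i * snd i) powr (- \<sigma>)" and "0 < e"
  obtains s where "s \<in> Hplane \<times> Hplane" "\<And>i. i \<in> I \<Longrightarrow> norm (dchar s i - z i) < e"
proof -
  have fin: "finite {p. (p, 1) \<in> I}" "finite {p. (1, p) \<in> I}"
    using I(1)
    by (auto intro: finite_subset[of _ "fst ` I"] finite_subset[of _ "snd ` I"] simp: rev_image_eqI)
  have prime: "prime p" if "p \<in> {p. (p, 1) \<in> I} \<or> p \<in> {p. (1, p) \<in> I}" for p
    using that I(2) by (auto simp: prime_gens_def)
  have norm_z: "norm (z (p, 1)) = real p powr (- \<sigma>)" if "p \<in> {p. (p, 1) \<in> I}" for p
    using z[of "(p, 1)"] that by simp
  have norm_z': "norm (z (1, p)) = real p powr (- \<sigma>)" if "p \<in> {p. (1, p) \<in> I}" for p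
    using z[of "(1, p)"] that by simp
  obtain s1 where s1: "Re s1 = \<sigma>" "\<And>p. (p, 1) \<in> I \<Longrightarrow> norm (of_nat p powr (- s1) - z (p, 1)) < e"
    using prime_powers_dense_in_torus[OF fin(1) prime \<open>0 \<le> \<sigma>\<close> norm_z \<open>0 < e\<close>] by auto
  obtain s2 where s2: "Re s2 = \<sigma>" "\<And>p. (1, p) \<in> I \<Longrightarrow> norm (of_nat p powr (- s2) - z (1, p)) < e"
    using prime_powers_dense_in_torus[OF fin(2) prime \<open>0 \<le> \<sigma>\<close> norm_z' \<open>0 < e\<close>] by auto
  show thesis
  proof (rule that[of "(s1, s2)"])
    show "(s1, s2) \<in> Hplane \<times> Hplane"
      using \<open>0 \<le> \<sigma>\<close> s1(1) s2(1) by (simp add: Hplane_def)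
    fix i assume i: "i \<in> I"
    then consider p where "i = (p, 1)" | p where "i = (1, p)"
      using I(2) by (auto simp: prime_gens_def)
    then show "norm (dchar (s1, s2) i - z i) < e"
      using i s1(2) s2(2) by cases (auto simp: dchar_def)
  qed
qed

lemma dirichlet_polyfun_lower_bound:
  assumes I: "finite I" "I \<subseteq> prime_gens" and P: "P \<in> polyfuns I" and "0 < k"
    and bound: "\<And>s. s \<in> Hplane \<times> Hplane \<Longrightarrow> k \<le> norm (P (dchar s))" and z: "z \<in> cpolydisc 1 I"
  shows "k \<le> norm (P z)"
proof -
  define q where "q i = ln (real (fst i * snd i))" for i :: "nat \<times> nat"
  have q: "0 < q i" if i: "i \<in> I" for i
  proof -
    obtain p where "prime p" "i = (p, 1) \<or> i = (1, p)"
      using i I(2) unfolding prime_gens_def by blast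
    then show ?thesis using prime_gt_1_nat[of p] by (auto simp: q_def)
  qed
  show ?thesis
  proof (rule polydisc_lower_bound[where G = P and I = I and r = "\<lambda>t i. t powr q i"])
    show "continuous_on {0..1} (\<lambda>t. t powr q i)" if "i \<in> I" for i
      using q[OF that] by (intro continuous_on_powr') (auto intro: continuous_intros)
    fix t :: real and z :: "nat \<times> nat \<Rightarrow> complex"
    assume t: "0 < t" "t \<le> 1" and z: "\<And>i. i \<in> I \<Longrightarrow> norm (z i) = t powr q i"
    have "t powr q i = real (fst i * snd i) powr (- (- ln t))" if "i \<in> I" for i
      using q[OF that] t(1) by (cases "fst i * snd i = 0") (auto simp: powr_def q_def mult.commute)
    then have "norm (z i) = real (fst i * snd i) powr (- (- ln t))" if "i \<in> I" for i
      using z that by simp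
    moreover have "0 \<le> - ln t" using t by simp
    ultimately have "\<exists>w. P w \<in> {v. k \<le> norm v} \<and> (\<forall>i\<in>I. norm (w i - z i) < e)" if "0 < e" for e
      using bound by (metis dchar_dense_in_torus[OF I _ _ that] mem_Collect_eq)
    then have "P z \<in> {v. k \<le> norm v}"
      using depends_on_polyfuns[OF P] continuous_on_polyfuns[OF P]
      by (intro closed_mem_coordinatewise_limit closed_Collect_le continuous_intros)
    then show "k \<le> norm (P z)" by simp
  qed (use I P \<open>0 < k\<close> z depends_on_polyfuns continuous_on_polyfuns holomorphic_on_polyfuns_slice
      in auto)
qed

lemma polynomially_generated_characters_N2:
  assumes "admissible_weight \<omega>"
  shows "polynomially_generated_characters N2_monoid \<omega> (Hplane \<times> Hplane) dchar prime_gens"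
proof -
  have "is_weight \<omega>" using assms by (simp add: admissible_weight_def)
  then interpret weighted_characters N2_monoid \<omega> "Hplane \<times> Hplane" dchar
    by (rule weighted_characters_N2)
  have gens: "prime_gens \<subseteq> N2" by (auto simp: prime_gens_def N2_def prime_gt_0_nat)
  show ?thesis
  proof unfold_locales
    show "(\<lambda>n. \<omega> (x [^]\<^bsub>N2_monoid\<^esub> n) powr (1 / real n)) \<longlonglongrightarrow> 1" if "x \<in> prime_gens" for x
      using assms that gens by (cases x) (auto simp: N2_monoid_pow admissible_weight_def)
    show "\<exists>P\<in>polyfuns prime_gens. \<forall>s\<in>Hplane \<times> Hplane. P (dchar s) = dchar s x"
      if "x \<in> carrier N2_monoid" for x
      using dchar_polyfun[of x] that by auto
  qed (use gens dirichlet_polyfun_lower_bound in auto)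
qed

lemma has_weighted_dirichlet_holomorphic_compose:
  assumes adm: "admissible_weight \<omega>" and f: "has_weighted_dirichlet \<omega> f"
    and "\<phi> holomorphic_on U" "open U" "closure (f ` (Hplane \<times> Hplane)) \<subseteq> U"
  shows "has_weighted_dirichlet \<omega> (\<phi> \<circ> f)"
proof -
  interpret polynomially_generated_characters N2_monoid \<omega> "Hplane \<times> Hplane" dchar prime_gens
    using adm by (rule polynomially_generated_characters_N2)
  have "is_weight \<omega>" using adm by (simp add: admissible_weight_def)
  then show ?thesis
    using weighted_norm_le_holomorphic_compose assms(2-5) by (auto simp: has_weighted_dirichlet_iff)
qed

lemma has_weighted_dirichlet_inverse:
  assumes adm: "admissible_weight \<omega>" and f: "has_weighted_dirichlet \<omega> f"
    and "0 < k" and k: "\<And>s. s \<in> Hplane \<times> Hplane \<Longrightarrow> k \<le> norm (f s)"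
  shows "has_weighted_dirichlet \<omega> (\<lambda>s. 1 / f s)"
proof -
  have "closed {v :: complex. k \<le> norm v}" by (intro closed_Collect_le continuous_intros)
  then have "closure (f ` (Hplane \<times> Hplane)) \<subseteq> {v. k \<le> norm v}"
    using k by (intro closure_minimal) auto
  then have "closure (f ` (Hplane \<times> Hplane)) \<subseteq> - {0}" using \<open>0 < k\<close> by auto
  moreover have "(\<lambda>v :: complex. 1 / v) holomorphic_on - {0}" by (intro holomorphic_intros) auto
  ultimately have "has_weighted_dirichlet \<omega> ((\<lambda>v. 1 / v) \<circ> f)"
    by (intro has_weighted_dirichlet_holomorphic_compose[OF adm f, of _ "- {0}"]) auto
  then show ?thesis by (simp add: o_def)
qed

section \<open>Almost monotone weights\<close>

lemma bounded_weight_admissible: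
  assumes w: "is_weight \<omega>" and bound: "\<And>x. x \<in> N2 \<Longrightarrow> \<omega> x \<le> B"
  shows "admissible_weight \<omega>"
proof -
  have "(\<lambda>n. \<omega> (l ^ n, k ^ n) powr (1 / real n)) \<longlonglongrightarrow> 1" if "(l, k) \<in> N2" for l k
  proof (rule tendsto_sandwich)
    have pow: "(l ^ n, k ^ n) \<in> N2" for n
      using that by (simp add: N2_def)
    have ge_1: "1 \<le> \<omega> (l ^ n, k ^ n)" for n
      using w pow[of n] by (simp add: is_weight_def)
    show "\<forall>\<^sub>F n in sequentially. 1 \<le> \<omega> (l ^ n, k ^ n) powr (1 / real n)"
      using ge_1 by (intro always_eventually allI ge_one_powr_ge_zero) auto
    show "\<forall>\<^sub>F n in sequentially. \<omega> (l ^ n, k ^ n) powr (1 / real n) \<le> B powr (1 / real n)"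
      by (simp add: powr_mono2 bound[OF pow] order_trans[OF zero_le_one ge_1])
    have "1 \<le> B" using ge_1 bound[OF pow] by (rule order_trans)
    then have "(\<lambda>n. B powr (1 / real n)) \<longlonglongrightarrow> B powr 0"
      by (intro tendsto_intros lim_const_over_n) auto
    then show "(\<lambda>n. B powr (1 / real n)) \<longlonglongrightarrow> 1" using \<open>1 \<le> B\<close> by simp
  qed simp
  with w show ?thesis by (simp add: admissible_weight_def)
qed

lemma monotone_weight_bounded:
  assumes w: "is_weight \<omega>" and "0 < K"
    and mono: "\<And>m1 n1 m2 n2. (m1, n1) \<in> N2 \<Longrightarrow> (m2, n2) \<in> N2 \<Longrightarrow> m1 dvd m2 \<or> n1 dvd n2 \<Longrightarrow>
      \<omega> (m1, n1) \<le> K * \<omega> (m2, n2)"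
    and x: "x \<in> N2"
  shows "\<omega> x \<le> (K * \<omega> (1, 1)) * (K * \<omega> (1, 1))"
proof -
  obtain m n where x_eq: "x = (m, n)" by fastforce
  have mem: "(m, 1) \<in> N2" "(1, n) \<in> N2" "(1, 1) \<in> N2"
    using x by (auto simp: x_eq N2_def)
  have "\<omega> (m * 1, 1 * n) \<le> \<omega> (m, 1) * \<omega> (1, n)"
    using w mem unfolding is_weight_def by blast
  also have "\<dots> \<le> (K * \<omega> (1, 1)) * (K * \<omega> (1, 1))"
  proof (rule mult_mono)
    show "\<omega> (m, 1) \<le> K * \<omega> (1, 1)" "\<omega> (1, n) \<le> K * \<omega> (1, 1)"
      using mem by (auto intro: mono)
    have "0 \<le> \<omega> y" if "y \<in> N2" for y
      using w that by (force simp: is_weight_def)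
    then show "0 \<le> K * \<omega> (1, 1)" "0 \<le> \<omega> (1, n)" using mem \<open>0 < K\<close> by auto
  qed
  finally show ?thesis by (simp add: x_eq)
qed

lemma almost_monotone_weight_admissible:
  assumes "almost_monotone_weight \<omega>"
  shows "admissible_weight \<omega>"
  using assms monotone_weight_bounded bounded_weight_admissible
  unfolding almost_monotone_weight_def by metis

theorem theorem1:
  fixes \<omega> :: "nat \<times> nat \<Rightarrow> real"
    and f :: "complex \<times> complex \<Rightarrow> complex"
  assumes am: "almost_monotone_weight \<omega>"
    and dir: "has_weighted_dirichlet \<omega> f"
  shows
    "((\<exists>k>0. \<forall>s\<in>Hplane \<times> Hplane. k \<le> norm (f s)) \<longrightarrow>
       (\<exists>\<nu>. almost_monotone_weight \<nu> \<and>
            (constant_weight \<nu> \<longleftrightarrow> constant_weight \<omega>) \<and>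
            (admissible_weight \<nu> \<longleftrightarrow> admissible_weight \<omega>) \<and>
            (\<forall>x\<in>N2. 1 \<le> \<nu> x \<and> \<nu> x \<le> \<omega> x) \<and>
            has_weighted_dirichlet \<nu> (\<lambda>s. 1 / f s)))
     \<and>
     (\<forall>(\<phi> :: complex \<Rightarrow> complex) U. open U \<longrightarrow> closure (f ` (Hplane \<times> Hplane)) \<subseteq> U \<longrightarrow>
        \<phi> holomorphic_on U \<longrightarrow>
       (\<exists>\<xi>. almost_monotone_weight \<xi> \<and>
            (constant_weight \<xi> \<longleftrightarrow> constant_weight \<omega>) \<and>
            (admissible_weight \<xi> \<longleftrightarrow> admissible_weight \<omega>) \<and>
            (\<forall>x\<in>N2. 1 \<le> \<xi> x \<and> \<xi> x \<le> \<omega> x) \<and>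
            has_weighted_dirichlet \<xi> (\<phi> \<circ> f)))"
proof -
  have adm: "admissible_weight \<omega>" using am by (rule almost_monotone_weight_admissible)
  then have "\<forall>x\<in>N2. 1 \<le> \<omega> x \<and> \<omega> x \<le> \<omega> x"
    by (simp add: admissible_weight_def is_weight_def)
  moreover have "has_weighted_dirichlet \<omega> (\<lambda>s. 1 / f s)"
    if "\<exists>k>0. \<forall>s\<in>Hplane \<times> Hplane. k \<le> norm (f s)"
    using that has_weighted_dirichlet_inverse[OF adm dir] by blast
  moreover have "has_weighted_dirichlet \<omega> (\<phi> \<circ> f)"
    if "open U" "closure (f ` (Hplane \<times> Hplane)) \<subseteq> U" "\<phi> holomorphic_on U" for \<phi> U
    using has_weighted_dirichlet_holomorphic_compose[OF adm dir] that by blast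
  ultimately show ?thesis using am by blast
qed

end
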